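(* Let $\{x_{j,n}: j=1,2,\ldots,2n\}$ be the zeros of $P_{n,n}$ (counted with multiplicity) and let $\mu_n$ be the normalized counting measure of the scaled zeros $x_{j,n}/n^{1/3}$, $$\mu_n=\frac{1}{2n}\sum_{j=1}^{2n}\delta_{x_{j,n}/n^{1/3}},\qquad n\ge1.$$ Then the sequence $(\mu_n)_n$ converges weakly to the probability measure $\mu$ on $\mathbb{C}$ for which $$\int f\,d\mu=\int_0^{(9/4)^{1/3}}v(x)\left[f(x)+f(\omega x)+f(\omega^2x)\right]dx,$$ where $\omega=e^{2\pi i/3}$ and, for $x\in[0,(9/4)^{1/3}]$, $$v(x)=\frac{\sqrt3}{4\pi}\Bigl(1+x[a(x)+b(x)]\Bigr)[b(x)-a(x)],$$ with $$a(x)=\left(\frac{3-\sqrt{9-4x^3}}{2}\right)^{1/3},\qquad b(x)=\left(\frac{3+\sqrt{9-4x^3}}{2}\right)^{1/3}$$ (nonnegative real roots).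
   Context: Let $\omega=e^{2\pi i/3}$ and, for $k=0,1,2$, let $\Gamma_k=\{r\omega^k: r\ge 0\}$ be the closed ray in $\mathbb{C}$ from the origin in direction $\omega^k$. All rays are oriented from left to right, so $\Gamma_0$ goes from $0$ to $+\infty$, while $\Gamma_1,\Gamma_2$ go from infinity to $0$. Thus for $j=1,2$ $$\int_{\Gamma_0\cup\Gamma_j} f(x)\,dx=\int_0^\infty f(t)\,dt-\omega^j\int_0^\infty f(\omega^j t)\,dt .$$ $P_{n,n}$ is the (unique) monic polynomial of degree $2n$ satisfying, for both $j=1$ and $j=2$, $$\int_{\Gamma_0\cup\Gamma_j}x^iP_{n,n}(x)e^{-x^3}dx=0,\qquad i=0,1,\ldots,n-1.$$ $\delta_z$ denotes the unit point mass at $z\in\mathbb{C}$. Weak convergence $\mu_n\to\mu$ means $\int f\,d\mu_n\to\int f\,d\mu$ for every bounded continuous $f:\mathbb{C}\to\mathbb{C}$. *)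

theory Defs
  imports
    "HOL-Probability.Probability"
    "HOL-Computational_Algebra.Computational_Algebra"
begin

definition omega :: complex where
  "omega = exp (2 * of_real pi * \<i> / 3)"

(* The integral over Gamma_0 \<union> Gamma_j, where Gamma_k = {r * omega^k | r >= 0}.  Gamma_0 is
   traversed from 0 to infinity and Gamma_j (j = 1, 2) from infinity to 0; parametrising
   Gamma_j by t \<mapsto> omega^j * t gives the factor omega^j, and its orientation gives the minus sign. *)
definition ray_integral :: "nat \<Rightarrow> (complex \<Rightarrow> complex) \<Rightarrow> complex" where
  "ray_integral j f =
     (LBINT t:{0..}. f (of_real t)) - omega ^ j * (LBINT t:{0..}. f (omega ^ j * of_real t))"

definition is_diagonal_mop :: "nat \<Rightarrow> complex poly \<Rightarrow> bool" where
  "is_diagonal_mop n p \<longleftrightarrow>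
     lead_coeff p = 1 \<and> degree p = 2 * n \<and>
     (\<forall>j\<in>{1, 2}. \<forall>i<n. ray_integral j (\<lambda>x. x ^ i * poly p x * exp (- (x ^ 3))) = 0)"

(* P_{n,n} *)
definition diagonal_mop :: "nat \<Rightarrow> complex poly" where
  "diagonal_mop n = (THE p. is_diagonal_mop n p)"

(* The multiset \<^const>\<open>proots\<close> lists the zeros with multiplicity; \<^term>\<open>return borel z\<close> is the
   unit point mass at z. *)
definition zero_measure :: "nat \<Rightarrow> complex measure" where
  "zero_measure n = measure_of UNIV (sets borel)
     (\<lambda>A. ennreal (1 / (2 * real n)) *
        (\<Sum>z\<in>#proots (diagonal_mop n). emeasure (return borel (z / of_real (root 3 (real n)))) A))"

definition converges_weakly :: "(nat \<Rightarrow> complex measure) \<Rightarrow> complex measure \<Rightarrow> bool" where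
  "converges_weakly M N \<longleftrightarrow>
     (\<forall>f :: complex \<Rightarrow> complex. continuous_on UNIV f \<longrightarrow> bounded (range f) \<longrightarrow>
        (\<lambda>n. integral\<^sup>L (M n) f) \<longlonglongrightarrow> integral\<^sup>L N f)"

definition a_fun :: "real \<Rightarrow> real" where
  "a_fun x = root 3 ((3 - sqrt (9 - 4 * x ^ 3)) / 2)"

definition b_fun :: "real \<Rightarrow> real" where
  "b_fun x = root 3 ((3 + sqrt (9 - 4 * x ^ 3)) / 2)"

definition v_fun :: "real \<Rightarrow> real" where
  "v_fun x = sqrt 3 / (4 * pi) * (1 + x * (a_fun x + b_fun x)) * (b_fun x - a_fun x)"

(* The measure is pinned down by its integrals of bounded Borel functions, which include the
   bounded continuous ones. *)
definition is_limit_measure :: "complex measure \<Rightarrow> bool" where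
  "is_limit_measure M \<longleftrightarrow>
     prob_space M \<and> sets M = sets borel \<and>
     (\<forall>f :: complex \<Rightarrow> complex. f \<in> borel_measurable borel \<longrightarrow> bounded (range f) \<longrightarrow>
        integral\<^sup>L M f =
          (LBINT x:{0..root 3 (9 / 4)}.
             of_real (v_fun x) *
             (f (of_real x) + f (omega * of_real x) + f (omega ^ 2 * of_real x))))"

end

theory Submission
  imports Defs
begin

text \<open>
  Splitting the exponents modulo 3 turns the orthogonality conditions into vanishing conditions for
  the Gamma-type moments of three polynomials in \<open>x\<^sup>3\<close>. The linear map \<open>x\<^sup>k \<mapsto> X (X + 1) \<cdots> (X + k - 1)\<close>
  translates them into prescribed zeros, whence \<open>P\<^sub>n\<^sub>,\<^sub>n\<close> is \<open>x\<^sup>r Q(x\<^sup>3)\<close> with \<open>r = 2 n mod 3\<close> and \<open>Q\<close> a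
  multiple Laguerre polynomial. Adding one prescribed zero \<open>c\<close> amounts to applying
  \<open>q \<mapsto> (x - c) q - x q'\<close>, which preserves the property of having only positive real zeros.
  The image of \<open>Q\<close> satisfies a first-order recurrence, so \<open>Q\<close> satisfies a third-order linear
  differential equation. The associated Riccati equation for \<open>x Q' / Q\<close>, expanded at infinity and
  rescaled by \<open>n\<close>, becomes in the limit a cubic equation for the generating function of the
  moments of the zeros. These moments are of Fuss-Catalan type and agree with the moments of the
  density, and since all zeros of \<open>Q\<close> are positive, convergence of moments yields weak convergence.
\<close>

text \<open>The moments of \<open>exp (- (x ^ 3))\<close> obey a one-term recursion in steps of 3,
  so integrating \<open>x ^ s\<close> times a polynomial in \<open>x ^ 3\<close> means, up to a
  positive factor, evaluating its transform at \<open>(s + 1) / 3\<close>. The prescribed zeros then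
  lie in two progressions of step 1. A shift by 1 changes the product over a progression only in its
  end factors, which is the source of the recurrence. The transform turns multiplication by x into a
  shift and a first-order differential operator into multiplication by \<open>- X\<close>, so the
  recurrence becomes a differential equation. With \<open>x = 1 / X\<close> and
  \<open>u = L - x\<close> the limiting cubic reads \<open>u ^ 3 + x * (u + 1 / 3) ^ 2 = 0\<close>.
  Working with power series at infinity avoids choosing a branch: each coefficient is determined by
  the earlier ones, both before and in the limit, so convergence is an induction on coefficients.
  There is no a priori bound on the largest zero; the growth of the limiting moments controls the
  tails. The binomial \<open>3 * k choose k\<close> grows like \<open>(27 / 4) ^ k\<close>, and
  division by \<open>3 ^ k\<close> leaves the endpoint \<open>9 / 4\<close> in the variable
  \<open>x ^ 3\<close>.\<close>

unbundle no vec_syntax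

section \<open>The factorial transform\<close>

text \<open>The linear map sending \<open>x\<^sup>k\<close> to \<open>X (X + 1) \<cdots> (X + k - 1)\<close>. Up to the factor \<open>Gamma c\<close>, its
  value at \<open>c\<close> is the integral of \<open>x\<^sup>c\<^sup>-\<^sup>1 p(x) exp (- x)\<close> over the positive half-line.\<close>
definition factorial_transform :: "'a::comm_ring_1 poly \<Rightarrow> 'a poly" where
  "factorial_transform p = fold_coeffs (\<lambda>a q. [:a:] + [:0, 1:] * pcompose q [:1, 1:]) p 0"

lemma factorial_transform_0 [simp]: "factorial_transform 0 = 0"
  by (simp add: factorial_transform_def)

lemma factorial_transform_pCons:
  "factorial_transform (pCons a p) = [:a:] + [:0, 1:] * pcompose (factorial_transform p) [:1, 1:]"
  by (cases "p = 0 \<and> a = 0") (auto simp: factorial_transform_def)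

lemma factorial_transform_add:
  "factorial_transform (p + q) = factorial_transform p + factorial_transform q"
  by (induction p q rule: poly_induct2)
     (simp_all add: factorial_transform_pCons pcompose_add algebra_simps del: mult_pCons_left)

lemma factorial_transform_smult:
  "factorial_transform (smult c p) = smult c (factorial_transform p)"
  by (induction p) (simp_all add: factorial_transform_pCons pcompose_smult smult_add_right)

lemma factorial_transform_uminus:
  "factorial_transform (- p) = - factorial_transform p"
  using factorial_transform_smult[of "-1" p] by simp

lemma factorial_transform_diff:
  "factorial_transform (p - q) = factorial_transform p - factorial_transform q"
  using factorial_transform_add[of p "- q"] by (simp add: factorial_transform_uminus)

lemma degree_lead_coeff_factorial_transform:
  fixes p :: "'a::idom poly"
  shows "degree (factorial_transform p) = degree p \<and>
         lead_coeff (factorial_transform p) = lead_coeff p"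
proof (induction p)
  case (pCons a p)
  show ?case
  proof (cases "p = 0")
    case False
    define q where "q = pcompose (factorial_transform p) [:1, 1:]"
    have T: "factorial_transform (pCons a p) = pCons a q"
      by (simp add: factorial_transform_pCons q_def)
    have "degree q = degree p"
      using pCons by (simp add: q_def degree_pcompose)
    moreover have "lead_coeff q = lead_coeff p"
      unfolding q_def by (subst lead_coeff_comp) (use pCons in auto)
    moreover from this have "q \<noteq> 0" using False by auto
    ultimately show ?thesis using False by (simp add: T)
  qed (simp add: factorial_transform_pCons)
qed simp

lemmas degree_factorial_transform [simp] =
  degree_lead_coeff_factorial_transform[THEN conjunct1]

lemmas lead_coeff_factorial_transform =
  degree_lead_coeff_factorial_transform[THEN conjunct2]

lemma factorial_transform_eq_0_iff [simp]:
  fixes p :: "'a::idom poly"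
  shows "factorial_transform p = 0 \<longleftrightarrow> p = 0"
  using lead_coeff_factorial_transform[of p] by (metis factorial_transform_0 leading_coeff_0_iff)

lemma factorial_transform_inj:
  fixes p q :: "'a::idom poly"
  assumes "factorial_transform p = factorial_transform q"
  shows "p = q"
  using assms factorial_transform_diff[of p q] by (metis cancel_comm_monoid_add_class.diff_cancel
    eq_iff_diff_eq_0 factorial_transform_eq_0_iff)

text \<open>Conjugation of \<open>x d/dx\<close> by \<open>exp (-x)\<close>.\<close>
definition weighted_euler :: "'a::idom poly \<Rightarrow> 'a poly" where
  "weighted_euler p = [:0, 1:] * (pderiv p - p)"

lemma factorial_transform_times_X:
  "factorial_transform ([:0, 1:] * p) = [:0, 1:] * pcompose (factorial_transform p) [:1, 1:]"
  by (simp add: factorial_transform_pCons)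

text \<open>Integration by parts in algebraic form: \<open>weighted_euler p * exp (- x)\<close> is x
  times the derivative of \<open>p * exp (- x)\<close>, so integrating it against
  \<open>x ^ (c - 1)\<close> gives \<open>- c\<close> times the integral of \<open>p\<close>.
  Induction on the coefficients replaces the integrals.\<close>

lemma factorial_transform_weighted_euler:
  "factorial_transform (weighted_euler p) = - ([:0, 1:] * factorial_transform p)"
proof (induction p)
  case (pCons a p)
  let ?X = "[:0, 1:] :: 'a poly"
  have "weighted_euler (pCons a p) = ?X * (p + weighted_euler p - [:a:])"
    by (simp add: weighted_euler_def pderiv_pCons algebra_simps)
  then have "factorial_transform (weighted_euler (pCons a p)) =
      ?X * pcompose (factorial_transform p - ?X * factorial_transform p - [:a:]) [:1, 1:]"
    by (simp only: factorial_transform_times_X factorial_transform_add factorial_transform_diff pCons)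
       (simp add: factorial_transform_pCons pcompose_add pcompose_diff pcompose_uminus pcompose_pCons)
  also have "\<dots> = - (?X * factorial_transform (pCons a p))"
    by (simp only: factorial_transform_pCons pcompose_diff pcompose_mult pcompose_pCons)
       (simp add: algebra_simps)
  finally show ?case .
qed (simp add: weighted_euler_def)

section \<open>Positivity of the zeros\<close>

lemma poly_pderiv_prod_mset_linear:
  fixes z :: "'a::field_char_0"
  assumes "poly (\<Prod>s\<in>#S. [:- s, 1:]) z \<noteq> 0"
  shows "poly (pderiv (\<Prod>s\<in>#S. [:- s, 1:])) z =
         poly (\<Prod>s\<in>#S. [:- s, 1:]) z * (\<Sum>s\<in>#S. 1 / (z - s))"
  using assms
proof (induction S)
  case (add s S)
  then have "z - s \<noteq> 0" "poly (\<Prod>s\<in>#S. [:- s, 1:]) z \<noteq> 0"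
    by (auto simp: algebra_simps)
  with add.IH show ?case
    by (simp add: pderiv_mult pderiv_pCons field_simps del: mult_pCons_left mult_pCons_right)
qed simp

lemma Im_mult_Im_inverse_nonpos: "Im z * Im (1 / (z - of_real s)) \<le> 0"
proof -
  have "Im z * Im (1 / (z - of_real s)) = - ((Im z)\<^sup>2 / (cmod (z - of_real s))\<^sup>2)"
    unfolding Im_divide cmod_power2 by (simp add: power2_eq_square)
  then show ?thesis by simp
qed

text \<open>Taking imaginary parts in \<open>\<Sum>s. 1 / (z - s) + c / z = 1\<close> shows that \<open>z\<close> is real, because
  all terms on the left have imaginary parts of the same sign.\<close>
lemma weighted_euler_root_pos:
  fixes S :: "real multiset" and c :: real and z :: complex
  defines "p \<equiv> (\<Prod>s\<in>#S. [:- complex_of_real s, 1:])"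
  assumes S: "\<And>s. s \<in># S \<Longrightarrow> s > 0" and c: "c > 0"
    and z: "poly (weighted_euler p + smult (of_real c) p) z = 0"
  shows "\<exists>s>0. z = of_real s"
proof (cases "poly p z = 0")
  case True
  then show ?thesis
    using S by (auto simp: p_def poly_prod_mset prod_mset_zero_iff)
next
  case False
  have p: "p = (\<Prod>s\<in>#image_mset complex_of_real S. [:- s, 1:])"
    by (simp add: p_def image_mset.compositionality o_def)
  define g where "g = (\<Sum>s\<in>#S. 1 / (z - of_real s))"
  have "poly (pderiv p) z = poly p z * g"
    using poly_pderiv_prod_mset_linear[of "image_mset complex_of_real S" z] False
    unfolding p by (simp add: g_def image_mset.compositionality o_def)
  with z have "poly p z * (z * g - z + of_real c) = 0"
    by (simp add: weighted_euler_def algebra_simps)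
  with False have eq: "z * g - z + of_real c = 0" by simp
  have "Im z = 0"
  proof (rule ccontr)
    assume im: "Im z \<noteq> 0"
    then have z0: "z \<noteq> 0" by auto
    with eq have "g + of_real c * (1 / (z - of_real 0)) = 1"
      by (simp add: field_simps)
    then have "Im z * Im (g + of_real c * (1 / (z - of_real 0))) = 0" by simp
    moreover have "Im z * Im g \<le> 0"
      unfolding g_def
    proof (induction S)
      case (add s S)
      then show ?case using Im_mult_Im_inverse_nonpos[of z s] by (simp add: algebra_simps)
    qed simp
    moreover have "Im z * Im (of_real c * (1 / (z - of_real 0))) < 0"
    proof -
      have "Im z * Im (of_real c * (1 / (z - of_real 0))) = - (c * (Im z)\<^sup>2 / (cmod z)\<^sup>2)"
        unfolding cmod_power2 by (simp add: Im_divide power2_eq_square)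
      then show ?thesis using c im z0 by simp
    qed
    ultimately show False by (simp add: algebra_simps)
  qed
  then obtain x where x: "z = of_real x" by (metis complex_is_Real_iff Reals_cases)
  \<comment> \<open>For \<open>x \<le> 0\<close> every term of \<open>h\<close> is negative or
    absent, so \<open>x * h\<close> and \<open>- x\<close> are nonnegative and cannot cancel the
    positive \<open>c\<close>.\<close>
  have "x > 0"
  proof (rule ccontr)
    assume "\<not> x > 0"
    then have x0: "x \<le> 0" by simp
    define h where "h = (\<Sum>s\<in>#S. 1 / (x - s))"
    have "g = of_real h" unfolding g_def h_def x by (induction S) simp_all
    with eq x have "complex_of_real (x * h - x + c) = 0" by simp
    then have "x * h - x + c = 0" using of_real_eq_0_iff by blast
    moreover have "h \<le> 0"
      unfolding h_def using S
    proof (induction S)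
      case (add s S)
      then have "s > 0" by simp
      then have "1 / (x - s) \<le> 0" using x0 by (simp add: divide_nonneg_neg)
      moreover have "(\<Sum>s\<in>#S. 1 / (x - s)) \<le> 0" using add by simp
      ultimately have "1 / (x - s) + (\<Sum>s\<in>#S. 1 / (x - s)) \<le> 0"
        by (rule add_nonpos_nonpos)
      then show ?case by simp
    qed simp
    ultimately show False using x0 c mult_nonpos_nonpos[of x h] by linarith
  qed
  with x show ?thesis by blast
qed

text \<open>Existence of the preimage and positivity of its zeros come from one induction on
  \<open>C\<close>: the operator that adds a prescribed zero is explicit, and its zeros are under
  control.\<close>

lemma factorial_transform_prod_linear_pos:
  fixes C :: "real set"
  assumes "finite C" and "\<And>c. c \<in> C \<Longrightarrow> c > 0"
  obtains S :: "real multiset" where "\<And>s. s \<in># S \<Longrightarrow> s > 0" and "size S = card C"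
    and "factorial_transform (\<Prod>s\<in>#S. [:- complex_of_real s, 1:]) = (\<Prod>c\<in>C. [:- of_real c, 1:])"
  using assms
proof (induction C arbitrary: thesis rule: finite_induct)
  case empty
  show ?case by (rule empty(1)[of "{#}"]) (simp_all add: factorial_transform_pCons one_pCons)
next
  case (insert c C)
  obtain S where S: "\<And>s. s \<in># S \<Longrightarrow> s > 0" "size S = card C"
    and T: "factorial_transform (\<Prod>s\<in>#S. [:- complex_of_real s, 1:]) = (\<Prod>c\<in>C. [:- of_real c, 1:])"
    using insert.IH insert.prems(2) by (metis insertCI)
  define p where "p = (\<Prod>s\<in>#S. [:- complex_of_real s, 1:])"
  \<comment> \<open>The sign compensates for \<open>weighted_euler\<close> acting as multiplication
    by \<open>- X\<close>: the transform gains exactly the factor \<open>X - c\<close>, and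
    \<open>q\<close> is monic.\<close>
  define q where "q = - (weighted_euler p + smult (of_real c) p)"
  have Tq: "factorial_transform q = (\<Prod>c\<in>insert c C. [:- of_real c, 1:])"
    using insert.hyps
    by (simp add: q_def factorial_transform_uminus factorial_transform_add factorial_transform_smult
        factorial_transform_weighted_euler T[folded p_def] del: add_uminus_conv_diff minus_add_distrib)
  have deg: "degree q = Suc (card C)"
  proof -
    have "degree (\<Prod>c\<in>insert c C. [:- complex_of_real c, 1:]) = card (insert c C)"
      by (subst degree_prod_sum_eq) auto
    with arg_cong[OF Tq, of degree] insert.hyps show ?thesis
      by (simp only: degree_factorial_transform card_insert_disjoint simp_thms)
  qed
  have lead: "lead_coeff q = 1"
    using arg_cong[OF Tq, of lead_coeff] 
    by (simp only: lead_coeff_factorial_transform lead_coeff_prod) simp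
  have roots: "\<exists>s>0. z = of_real s" if "z \<in># proots q" for z
  proof (rule weighted_euler_root_pos[of S c z, folded p_def])
    have "q \<noteq> 0" using lead by auto
    with that have "poly q z = 0" by simp
    then show "poly (weighted_euler p + smult (of_real c) p) z = 0"
      by (simp only: q_def poly_minus neg_equal_0_iff_equal)
  qed (use S insert.prems in auto)
  show ?case
  proof (rule insert.prems(1))
    \<comment> \<open>All zeros being real, \<open>Re\<close> followed by
      \<open>complex_of_real\<close> changes nothing, so the complex factorisation of
      \<open>q\<close> can be indexed by a real multiset.\<close>
    have "image_mset complex_of_real (image_mset Re (proots q)) = image_mset (\<lambda>z. z) (proots q)"
      unfolding image_mset.compositionality
      by (rule image_mset_cong) (use roots in force)
    then have eq: "image_mset complex_of_real (image_mset Re (proots q)) = proots q" by simp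
    have "(\<Prod>s\<in>#image_mset Re (proots q). [:- complex_of_real s, 1:]) =
          (\<Prod>z\<in>#image_mset complex_of_real (image_mset Re (proots q)). [:- z, 1:])"
      by (simp add: image_mset.compositionality o_def)
    also have "\<dots> = q"
      unfolding eq using complex_poly_decompose_multiset[of q] lead by simp
    finally show "factorial_transform (\<Prod>s\<in>#image_mset Re (proots q). [:- complex_of_real s, 1:]) =
        (\<Prod>c\<in>insert c C. [:- of_real c, 1:])"
      by (simp add: Tq)
    show "size (image_mset Re (proots q)) = card (insert c C)"
      using deg insert.hyps by (simp add: size_proots_complex)
    show "s > 0" if "s \<in># image_mset Re (proots q)" for s
      using that roots by fastforce
  qed
qed

section \<open>The differential equation of third order\<close>

text \<open>The shift moves the zeros \<open>a, ..., a + n - 1\<close> to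
  \<open>a - 1, ..., a + n - 2\<close>. With the extra factor, each side has the zeros
  \<open>a - 1, ..., a + n - 1\<close>.\<close>

lemma pcompose_prod_linear_progression:
  fixes a :: "'a::idom"
  shows "[:1 - a - of_nat n, 1:] * pcompose (\<Prod>m<n. [:- (a + of_nat m), 1:]) [:1, 1:] =
         [:1 - a, 1:] * (\<Prod>m<n. [:- (a + of_nat m), 1:])"
proof (induction n)
  case (Suc n)
  let ?P = "\<Prod>m<n. [:- (a + of_nat m), 1:]"
  have comp: "pcompose [:- (a + of_nat n), 1:] [:1, 1:] = [:1 - a - of_nat n, 1:]"
    and eq: "[:1 - a - of_nat (Suc n), 1:] = [:- (a + of_nat n), 1:]"
    by (simp_all add: pcompose_pCons)
  have "[:1 - a - of_nat (Suc n), 1:] * pcompose (\<Prod>m<Suc n. [:- (a + of_nat m), 1:]) [:1, 1:]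
      = [:1 - a - of_nat (Suc n), 1:] * ([:1 - a - of_nat n, 1:] * pcompose ?P [:1, 1:])"
    by (simp only: prod.lessThan_Suc pcompose_mult comp mult_ac)
  also have "\<dots> = [:- (a + of_nat n), 1:] * ([:1 - a, 1:] * ?P)"
    unfolding Suc eq ..
  also have "\<dots> = [:1 - a, 1:] * (\<Prod>m<Suc n. [:- (a + of_nat m), 1:])"
    by (simp only: prod.lessThan_Suc mult_ac)
  finally show ?case .
qed (simp add: pcompose_1)

text \<open>In operator form the equation is
  \<open>D (D + a - 1) (D + b - 1) q = - x (D + a + k) (D + b + l) q\<close>. The transform turns
  \<open>D\<close> into \<open>- X\<close> and x into \<open>X\<close> times the shift; what remains
  is the product of the shift identities of the two progressions, and injectivity leads back. Since
  \<open>D\<close> has order one, the order is three.\<close>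

lemma multiple_Laguerre_ode:
  fixes a b :: "'a::idom"
  assumes T: "factorial_transform q =
    (\<Prod>m<k. [:- (a + of_nat m), 1:]) * (\<Prod>m<l. [:- (b + of_nat m), 1:])"
  defines "D \<equiv> weighted_euler"
  shows "D (D (D q)) + smult (a + b - 2) (D (D q)) + smult ((a - 1) * (b - 1)) (D q) =
    - ([:0, 1:] * (D (D q) + smult (a + of_nat k + b + of_nat l) (D q)
        + smult ((a + of_nat k) * (b + of_nat l)) q))"
proof (rule factorial_transform_inj)
  define t where "t = factorial_transform q"
  define X where "X = [:0, 1 :: 'a:]"
  define ta where "ta = (\<Prod>m<k. [:- (a + of_nat m), 1:])"
  define tb where "tb = (\<Prod>m<l. [:- (b + of_nat m), 1:])"
  have t: "t = ta * tb" using T by (simp add: t_def ta_def tb_def)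
  have lin: "[:c, 1:] = X + [:c:]" for c by (simp add: X_def)
  have smult2: "smult 2 p = p * 2" for p :: "'a poly" by (simp add: numeral_poly)
  have TD: "factorial_transform (D p) = - (X * factorial_transform p)" for p
    by (simp only: D_def X_def factorial_transform_weighted_euler)
  have "factorial_transform (D (D (D q)) + smult (a + b - 2) (D (D q)) + smult ((a - 1) * (b - 1)) (D q))
      = - (X * ([:1 - a, 1:] * [:1 - b, 1:] * t))"
    unfolding factorial_transform_add factorial_transform_smult TD t_def[symmetric] lin
    by (simp add: algebra_simps smult_add_left smult_diff_left smult2)
  also have "[:1 - a, 1:] * [:1 - b, 1:] * t = ([:1 - a, 1:] * ta) * ([:1 - b, 1:] * tb)"
    unfolding t by (simp only: mult_ac)
  also have "\<dots> = ([:1 - a - of_nat k, 1:] * pcompose ta [:1, 1:]) *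
                  ([:1 - b - of_nat l, 1:] * pcompose tb [:1, 1:])"
    unfolding ta_def tb_def pcompose_prod_linear_progression ..
  also have "\<dots> = pcompose ([:- (a + of_nat k), 1:] * [:- (b + of_nat l), 1:] * t) [:1, 1:]"
  proof -
    have "pcompose [:- c, 1:] [:1, 1:] = [:1 - c, 1:]" for c :: 'a
      by (simp add: pcompose_pCons)
    then show ?thesis
      unfolding t pcompose_mult by (simp only: mult_ac diff_diff_eq)
  qed
  also have "[:- (a + of_nat k), 1:] * [:- (b + of_nat l), 1:] * t =
      factorial_transform (D (D q) + smult (a + of_nat k + b + of_nat l) (D q)
        + smult ((a + of_nat k) * (b + of_nat l)) q)"
    unfolding factorial_transform_add factorial_transform_smult TD t_def[symmetric] lin
    by (simp add: algebra_simps smult_add_left smult_diff_left)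
  finally show "factorial_transform (D (D (D q)) + smult (a + b - 2) (D (D q))
      + smult ((a - 1) * (b - 1)) (D q)) =
    factorial_transform (- ([:0, 1:] * (D (D q) + smult (a + of_nat k + b + of_nat l) (D q)
        + smult ((a + of_nat k) * (b + of_nat l)) q)))"
    by (simp only: factorial_transform_uminus factorial_transform_times_X X_def)
qed

section \<open>The Riccati equation for power sums\<close>

definition fls_euler :: "'a::field_char_0 fls \<Rightarrow> 'a fls" where
  "fls_euler f = - (fls_X * fls_deriv f)"

lemma fls_euler_add: "fls_euler (f + g) = fls_euler f + fls_euler g"
  and fls_euler_diff: "fls_euler (f - g) = fls_euler f - fls_euler g"
  and fls_euler_mult: "fls_euler (f * g) = f * fls_euler g + fls_euler f * g"
  and fls_euler_const [simp]: "fls_euler (fls_const c) = 0"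
  by (simp_all add: fls_euler_def algebra_simps)

lemma fls_euler_const_mult: "fls_euler (fls_const c * f) = fls_const c * fls_euler f"
  by (simp add: fls_euler_mult)

lemma fls_X_times_X_inv [simp]: "fls_X * fls_X_inv = (1 :: 'a::field fls)"
  by (simp flip: fls_inverse_X)

lemma fls_euler_X_inv: "fls_euler fls_X_inv = fls_X_inv"
  by (simp add: fls_euler_def power2_eq_square flip: mult.assoc)

text \<open>The variable of \<open>p\<close> is \<open>c / X\<close>, so that \<open>fls_euler\<close> is the Euler operator \<open>x d/dx\<close> of that variable.\<close>
definition fls_at_inf :: "'a::field_char_0 \<Rightarrow> 'a poly \<Rightarrow> 'a fls" where
  "fls_at_inf c p = poly (map_poly fls_const p) (fls_const c * fls_X_inv)"

lemma fls_at_inf_0 [simp]: "fls_at_inf c 0 = 0"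
  by (simp add: fls_at_inf_def)

lemma fls_at_inf_pCons:
  "fls_at_inf c (pCons a p) = fls_const a + fls_const c * fls_X_inv * fls_at_inf c p"
  by (cases "p = 0 \<and> a = 0") (auto simp: fls_at_inf_def map_poly_pCons)

lemma fls_at_inf_add: "fls_at_inf c (p + q) = fls_at_inf c p + fls_at_inf c q"
  by (induction p q rule: poly_induct2)
     (simp_all add: fls_at_inf_pCons algebra_simps fls_plus_const)

lemma fls_at_inf_smult: "fls_at_inf c (smult a p) = fls_const a * fls_at_inf c p"
  by (induction p) (simp_all add: fls_at_inf_pCons algebra_simps)

lemma fls_at_inf_uminus: "fls_at_inf c (- p) = - fls_at_inf c p"
  using fls_at_inf_smult[of c "-1" p] by simp

lemma fls_at_inf_mult: "fls_at_inf c (p * q) = fls_at_inf c p * fls_at_inf c q"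
  by (induction p) (simp_all add: fls_at_inf_pCons fls_at_inf_add fls_at_inf_smult algebra_simps)

lemma fls_at_inf_X: "fls_at_inf c [:0, 1:] = fls_const c * fls_X_inv"
  by (simp add: fls_at_inf_pCons)

lemma fls_euler_at_inf:
  "fls_euler (fls_at_inf c p) = fls_at_inf c ([:0, 1:] * pderiv p)"
proof (induction p)
  case (pCons a p)
  have "fls_euler (fls_at_inf c (pCons a p)) =
      fls_const c * fls_X_inv * (fls_at_inf c p + fls_euler (fls_at_inf c p))"
    by (simp add: fls_at_inf_pCons fls_euler_add fls_euler_mult fls_euler_X_inv algebra_simps)
  also have "\<dots> = fls_at_inf c ([:0, 1:] * pderiv (pCons a p))"
    unfolding pCons pderiv_pCons
    by (simp add: fls_at_inf_pCons fls_at_inf_add)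
  finally show ?case .
qed (simp add: fls_euler_def)

lemma fls_at_inf_weighted_euler:
  "fls_at_inf c (weighted_euler p) =
   fls_euler (fls_at_inf c p) - fls_const c * fls_X_inv * fls_at_inf c p"
proof -
  have "weighted_euler p = [:0, 1:] * pderiv p + - ([:0, 1:] * p)"
    by (simp add: weighted_euler_def algebra_simps)
  then show ?thesis
    by (simp only: fls_at_inf_add fls_at_inf_uminus fls_at_inf_mult fls_euler_at_inf fls_at_inf_X)
       simp
qed

text \<open>For the monic \<open>q\<close> with zeros \<open>S\<close> this is
  \<open>x * q'(x) / q(x)\<close> expanded at infinity in the variable \<open>x = c / X\<close>. The
  scale \<open>c\<close> will be n. The constant term counts the zeros.\<close>

definition power_sum_fps :: "'a::field_char_0 multiset \<Rightarrow> 'a \<Rightarrow> 'a fps" where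
  "power_sum_fps S c = Abs_fps (\<lambda>k. \<Sum>s\<in>#S. (s / c) ^ k)"

text \<open>This is \<open>x = (x - s) / (1 - s / x)\<close> with the quotient expanded as a
  geometric series at infinity.\<close>

lemma fls_at_inf_linear_factor:
  assumes "c \<noteq> 0"
  shows "fls_const c * fls_X_inv =
    fls_at_inf c [:- s, 1:] * fps_to_fls (Abs_fps (\<lambda>k. (s / c) ^ k))"
proof -
  let ?g = "Abs_fps (\<lambda>k. (s / c) ^ k)"
  have "(1 - fps_const (s / c) * fps_X) * ?g = 1"
  proof (rule fps_ext)
    fix k show "((1 - fps_const (s / c) * fps_X) * ?g) $ k = 1 $ k"
      by (cases k) (simp_all add: algebra_simps mult.assoc)
  qed
  then have "fps_to_fls ((1 - fps_const (s / c) * fps_X) * ?g) = 1" by simp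
  then have 1: "(1 - fls_const (s / c) * fls_X) * fps_to_fls ?g = 1"
    by (simp add: fls_times_fps_to_fls)
  have "fls_const c * fls_X_inv * (fls_const (s / c) * fls_X) = 
      (fls_const c * fls_const (s / c)) * (fls_X * fls_X_inv)"
    by (simp only: mult_ac)
  also have "\<dots> = fls_const s"
    using assms by simp
  finally have "fls_const c * fls_X_inv * (1 - fls_const (s / c) * fls_X) = fls_at_inf c [:- s, 1:]"
    by (simp add: fls_at_inf_pCons right_diff_distrib)
  moreover have "fls_const c * fls_X_inv =
      fls_const c * fls_X_inv * ((1 - fls_const (s / c) * fls_X) * fps_to_fls ?g)"
    by (simp only: 1 mult_1_right)
  ultimately show ?thesis by (simp only: flip: mult.assoc)
qed

lemma fls_euler_at_inf_prod_linear:
  assumes "c \<noteq> 0"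
  shows "fls_euler (fls_at_inf c (\<Prod>s\<in>#S. [:- s, 1:])) =
    fps_to_fls (power_sum_fps S c) * fls_at_inf c (\<Prod>s\<in>#S. [:- s, 1:])"
proof (induction S)
  case empty
  have "power_sum_fps {#} c = 0" by (rule fps_ext) (simp add: power_sum_fps_def)
  then show ?case by (simp add: one_pCons fls_at_inf_pCons fls_euler_def)
next
  case (add s S)
  let ?g = "Abs_fps (\<lambda>k. (s / c) ^ k)"
  let ?P = "\<Prod>s\<in>#S. [:- s, 1:]"
  have g: "fls_euler (fls_at_inf c [:- s, 1:]) = fls_at_inf c [:- s, 1:] * fps_to_fls ?g"
    using fls_at_inf_linear_factor[OF assms, of s]
    by (simp add: fls_at_inf_pCons fls_euler_diff fls_euler_const_mult fls_euler_X_inv)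
  have "power_sum_fps (add_mset s S) c = ?g + power_sum_fps S c"
    by (rule fps_ext) (simp add: power_sum_fps_def)
  then show ?case
    using add g
    by (simp add: fls_at_inf_mult fls_euler_mult algebra_simps del: mult_pCons_left)
qed

text \<open>The logarithmic derivative turns the linear equation of order three into a Riccati equation
  of order two for the generating function of the power sums.\<close>
lemma power_sum_riccati:
  fixes a b c :: "'a::field_char_0" and S :: "'a multiset"
  assumes c: "c \<noteq> 0"
  defines "q \<equiv> \<Prod>s\<in>#S. [:- s, 1:]"
  assumes T: "factorial_transform q =
    (\<Prod>m<k. [:- (a + of_nat m), 1:]) * (\<Prod>m<l. [:- (b + of_nat m), 1:])"
  defines "A \<equiv> power_sum_fps S c"
  defines "A1 \<equiv> - (fps_X * fps_deriv A)"
  defines "A2 \<equiv> - (fps_X * fps_deriv A1)"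
  defines "K \<equiv> fps_const"
  shows "K (c\<^sup>2) * A = K (c\<^sup>2) * K (of_nat (k + l))
     + K c * fps_X * (2 * A\<^sup>2 + 3 * A + 2 * A1 + 1 + K (a + b - 2) * (2 * A + 1)
          + K ((a - 1) * (b - 1)) - K (a + of_nat k + b + of_nat l) * A - K ((a + of_nat k) * (b + of_nat l)))
     - fps_X\<^sup>2 * (A ^ 3 + 3 * A * A1 + A2 + K (a + b - 2) * (A\<^sup>2 + A1) + K ((a - 1) * (b - 1)) * A)"
proof -
  define F where "F = fls_at_inf c"
  define Q where "Q = F q"
  define x where "x = fls_const c * fls_X_inv"
  define D where "D = (\<lambda>f. fls_euler f - x * f)"
  define L where "L = fps_to_fls A"
  define L1 where "L1 = fls_euler L"
  define L2 where "L2 = fls_euler L1"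
  define u where "u = L - x"
  have FD: "F (weighted_euler p) = D (F p)" for p
    by (simp add: F_def D_def fls_at_inf_weighted_euler x_def)
  have ex: "fls_euler x = x" by (simp add: x_def fls_euler_const_mult fls_euler_X_inv)
  have u1: "fls_euler u = L1 - x" by (simp add: u_def fls_euler_diff ex L1_def)
  have u2: "fls_euler (L1 - x) = L2 - x" by (simp add: fls_euler_diff ex L2_def)
  have eQ: "fls_euler Q = L * Q"
    unfolding Q_def F_def q_def L_def A_def by (rule fls_euler_at_inf_prod_linear[OF c])
  \<comment> \<open>After division by \<open>Q\<close>, the operator \<open>D\<close> acts as the
    Euler derivative plus multiplication by \<open>u\<close>. Starting from \<open>w = 1\<close>,
    all iterates on \<open>Q\<close> become \<open>Q\<close> times expressions in \<open>u\<close>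
    and its Euler derivatives.\<close>
  have D: "D (w * Q) = (fls_euler w + w * u) * Q" for w
    by (simp add: D_def fls_euler_mult eQ u_def algebra_simps)
  have D1: "D Q = u * Q" using D[of 1] by (simp add: fls_euler_def)
  have D2: "D (D Q) = (L1 - x + u * u) * Q" by (simp add: D1 D u1)
  have D3: "D (D (D Q)) = (L2 - x + 3 * u * (L1 - x) + u ^ 3) * Q"
    unfolding D2 D fls_euler_add fls_euler_mult u1 u2
    by (simp add: algebra_simps power3_eq_cube)
  have Q0: "Q \<noteq> 0"
  proof -
    have "F [:- s, 1:] \<noteq> 0" for s
      using fls_at_inf_linear_factor[OF c, of s] c by (auto simp: F_def)
    then have "F (\<Prod>s\<in>#M. [:- s, 1:]) \<noteq> 0" for M
      by (induction M) (simp_all add: F_def fls_at_inf_mult one_pCons fls_at_inf_pCons 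
        del: mult_pCons_left)
    then show ?thesis by (simp add: Q_def q_def)
  qed
  define e1 where "e1 = fls_const (a + b - 2)"
  define e0 where "e0 = fls_const ((a - 1) * (b - 1))"
  define d1 where "d1 = fls_const (a + of_nat k + b + of_nat l)"
  define d0 where "d0 = fls_const ((a + of_nat k) * (b + of_nat l))"
  have "D (D (D Q)) + e1 * D (D Q) + e0 * D Q = - (x * (D (D Q) + d1 * D Q + d0 * Q))"
    using arg_cong[OF multiple_Laguerre_ode[OF T], of F]
    unfolding Q_def FD[symmetric] e1_def e0_def d1_def d0_def x_def
    by (simp only: F_def fls_at_inf_add fls_at_inf_smult fls_at_inf_uminus fls_at_inf_mult
        fls_at_inf_X)
  then have "Q * (L2 - x + 3 * u * (L1 - x) + u ^ 3 + e1 * (L1 - x + u * u) + e0 * u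
      + x * (L1 - x + u * u + d1 * u + d0)) = 0"
    unfolding D3 unfolding D2 unfolding D1 by (simp add: algebra_simps)
  then have "L2 - x + 3 * u * (L1 - x) + u ^ 3 + e1 * (L1 - x + u * u) + e0 * u
      + x * (L1 - x + u * u + d1 * u + d0) = 0" using Q0 by simp
  \<comment> \<open>The cubes of \<open>x\<close> coming from \<open>u ^ 3\<close> and
    \<open>x * u * u\<close> cancel. The highest remaining term is quadratic in \<open>x\<close>, so
    two factors \<open>fls_X\<close> remove all poles, and its coefficient compares \<open>L\<close>
    with the number \<open>k + l\<close> of zeros.\<close>
  then have "fls_X\<^sup>2 * (x * x * (L - (d1 - e1 - 2))
     - x * (2 * L\<^sup>2 + 3 * L + 2 * L1 + 1 + e1 * (2 * L + 1) + e0 - d1 * L - d0)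
     + (L ^ 3 + 3 * L * L1 + L2 + e1 * (L\<^sup>2 + L1) + e0 * L)) = 0"
    unfolding u_def by (simp add: algebra_simps power2_eq_square power3_eq_cube)
  moreover have "d1 - e1 - 2 = fls_const (of_nat (k + l))"
  proof -
    have "d1 - e1 - 2 = fls_const ((a + of_nat k + b + of_nat l) - (a + b - 2) - 2)"
      by (simp only: d1_def e1_def fls_minus_const fls_const_numeral[symmetric])
    then show ?thesis by simp
  qed
  moreover have xX: "fls_X * x = fls_const c"
  proof -
    have "fls_X * x = fls_const c * (fls_X * fls_X_inv)" unfolding x_def by (simp only: mult_ac)
    then show ?thesis by simp
  qed
  ultimately have "fls_const c * fls_const c * (L - fls_const (of_nat (k + l)))
     - fls_const c * fls_X * (2 * L\<^sup>2 + 3 * L + 2 * L1 + 1 + e1 * (2 * L + 1) + e0 - d1 * L - d0)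
     + fls_X\<^sup>2 * (L ^ 3 + 3 * L * L1 + L2 + e1 * (L\<^sup>2 + L1) + e0 * L) = 0"
    unfolding xX[symmetric] by (simp add: algebra_simps power2_eq_square)
  moreover have "L1 = fps_to_fls A1" "L2 = fps_to_fls A2"
    by (simp_all add: L1_def L2_def L_def A1_def A2_def fls_euler_def fls_deriv_fps_to_fls
        fls_times_fps_to_fls)
  ultimately have "fps_to_fls (K c * K c * (A - K (of_nat (k + l)))
     - K c * fps_X * (2 * A\<^sup>2 + 3 * A + 2 * A1 + 1 + K (a + b - 2) * (2 * A + 1) 
         + K ((a - 1) * (b - 1)) - K (a + of_nat k + b + of_nat l) * A - K ((a + of_nat k) * (b + of_nat l)))
     + fps_X\<^sup>2 * (A ^ 3 + 3 * A * A1 + A2 + K (a + b - 2) * (A\<^sup>2 + A1) + K ((a - 1) * (b - 1)) * A)) = 0"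
    by (simp only: L_def fls_times_fps_to_fls fps_to_fls_power K_def e1_def e0_def d1_def d0_def
        fps_to_fls_plus fps_to_fls_minus fps_const_to_fls fps_to_fls_numeral fps_X_to_fls
        fps_one_to_fls)
  then have zero: "K c * K c * (A - K (of_nat (k + l)))
     - K c * fps_X * (2 * A\<^sup>2 + 3 * A + 2 * A1 + 1 + K (a + b - 2) * (2 * A + 1) 
         + K ((a - 1) * (b - 1)) - K (a + of_nat k + b + of_nat l) * A - K ((a + of_nat k) * (b + of_nat l)))
     + fps_X\<^sup>2 * (A ^ 3 + 3 * A * A1 + A2 + K (a + b - 2) * (A\<^sup>2 + A1) + K ((a - 1) * (b - 1)) * A) = 0"
    unfolding fps_to_fls_eq_0_iff .
  have solve: "u * A = u * v + P - R" if "u * (A - v) - P + R = 0" for u v P R :: "'a fps"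
  proof -
    have "u * A = (u * (A - v) - P + R) + (u * v + P - R)" by (simp add: algebra_simps)
    with that show ?thesis by simp
  qed
  have "K (c\<^sup>2) = K c * K c" by (simp add: K_def power2_eq_square)
  then show ?thesis using solve[OF zero] by (simp only:)
qed

section \<open>Coefficientwise limits\<close>

text \<open>Only the first \<open>k\<close> coefficients are required to converge. A factor
  \<open>fps_X\<close> raises this number by one, and that gain drives the induction over the
  Riccati equation.\<close>

definition fps_tendsto_upto :: "nat \<Rightarrow> (nat \<Rightarrow> 'a::real_normed_field fps) \<Rightarrow> 'a fps \<Rightarrow> bool" where
  "fps_tendsto_upto k F G \<longleftrightarrow> (\<forall>j<k. (\<lambda>n. F n $ j) \<longlonglongrightarrow> G $ j)"

named_theorems fps_tendsto

lemma fps_tendsto_upto_const [fps_tendsto]: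
  "c \<longlonglongrightarrow> c' \<Longrightarrow> fps_tendsto_upto k (\<lambda>n. fps_const (c n)) (fps_const c')"
  by (auto simp: fps_tendsto_upto_def)

lemma fps_tendsto_upto_refl [fps_tendsto]: "fps_tendsto_upto k (\<lambda>n. F) F"
  by (auto simp: fps_tendsto_upto_def)

lemma fps_tendsto_upto_add [fps_tendsto]:
  "fps_tendsto_upto k F F' \<Longrightarrow> fps_tendsto_upto k G G' \<Longrightarrow>
   fps_tendsto_upto k (\<lambda>n. F n + G n) (F' + G')"
  by (auto simp: fps_tendsto_upto_def intro: tendsto_add)

lemma fps_tendsto_upto_diff [fps_tendsto]:
  "fps_tendsto_upto k F F' \<Longrightarrow> fps_tendsto_upto k G G' \<Longrightarrow>
   fps_tendsto_upto k (\<lambda>n. F n - G n) (F' - G')"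
  by (auto simp: fps_tendsto_upto_def intro: tendsto_diff)

lemma fps_tendsto_upto_uminus [fps_tendsto]:
  "fps_tendsto_upto k F F' \<Longrightarrow> fps_tendsto_upto k (\<lambda>n. - F n) (- F')"
  by (auto simp: fps_tendsto_upto_def intro: tendsto_minus)

lemma fps_tendsto_upto_mult [fps_tendsto]:
  "fps_tendsto_upto k F F' \<Longrightarrow> fps_tendsto_upto k G G' \<Longrightarrow>
   fps_tendsto_upto k (\<lambda>n. F n * G n) (F' * G')"
  unfolding fps_tendsto_upto_def fps_mult_nth by (auto intro!: tendsto_intros)

lemma fps_tendsto_upto_power [fps_tendsto]:
  "fps_tendsto_upto k F F' \<Longrightarrow> fps_tendsto_upto k (\<lambda>n. F n ^ m) (F' ^ m)"
  by (induction m) (auto intro: fps_tendsto)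

text \<open>The factor \<open>fps_X\<close> keeps the index in place: coefficient \<open>j\<close>
  is multiplied by \<open>j\<close>. The derivative alone would cost one known coefficient.\<close>

lemma fps_tendsto_upto_X_deriv [fps_tendsto]:
  "fps_tendsto_upto k F F' \<Longrightarrow>
   fps_tendsto_upto k (\<lambda>n. fps_X * fps_deriv (F n)) (fps_X * fps_deriv F')"
  unfolding fps_tendsto_upto_def by (auto intro!: tendsto_intros)

lemma fps_tendsto_upto_Suc_X_mult:
  "fps_tendsto_upto k F F' \<Longrightarrow> fps_tendsto_upto (Suc k) (\<lambda>n. fps_X * F n) (fps_X * F')"
  unfolding fps_tendsto_upto_def by auto

lemma fps_tendsto_uptoD: "fps_tendsto_upto k F F' \<Longrightarrow> j < k \<Longrightarrow> (\<lambda>n. F n $ j) \<longlonglongrightarrow> F' $ j"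
  by (auto simp: fps_tendsto_upto_def)

text \<open>The Riccati equation is divided by \<open>c ^ 3\<close>, and the factors are distributed
  so that every parameter occurs divided by \<open>c\<close>. All terms with derivatives then carry
  a factor \<open>h = 1 / c\<close> and disappear as \<open>c\<close> grows.\<close>

lemma normalised_riccati:
  fixes c :: "'a::field_char_0" and S :: "'a multiset"
  assumes c: "c \<noteq> 0"
  assumes T: "factorial_transform (\<Prod>s\<in>#S. [:- s, 1:]) =
    (\<Prod>m<k. [:- (a + of_nat m), 1:]) * (\<Prod>m<l. [:- (b + of_nat m), 1:])"
  defines "B \<equiv> fps_const (1 / c) * power_sum_fps S c"
  defines "B1 \<equiv> - (fps_X * fps_deriv B)"
  defines "B2 \<equiv> - (fps_X * fps_deriv B1)"
  defines "h \<equiv> fps_const (1 / c)"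
  defines "p \<equiv> fps_const ((a - 1) / c)" and "q \<equiv> fps_const ((b - 1) / c)"
  defines "k' \<equiv> fps_const (of_nat k / c)" and "l' \<equiv> fps_const (of_nat l / c)"
  defines "u \<equiv> fps_const (a / c + of_nat k / c)" and "v \<equiv> fps_const (b / c + of_nat l / c)"
  shows "B = k' + l' + fps_X * (2 * B\<^sup>2 + h * (3 * B + 2 * B1) + 2 * (p + q) * B
      + h\<^sup>2 + h * (p + q) + p * q - (u + v) * B - u * v)
    - fps_X * (fps_X * (B ^ 3 + 3 * h * B * B1 + (p + q) * B\<^sup>2 + h\<^sup>2 * B2 + h * (p + q) * B1 + p * q * B))"
proof -
  define A where "A = power_sum_fps S c"
  define A1 where "A1 = - (fps_X * fps_deriv A)"
  define A2 where "A2 = - (fps_X * fps_deriv A1)"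
  have B: "B = h * A" "B1 = h * A1" "B2 = h * A2"
    by (simp_all add: B_def A_def h_def B1_def B2_def A1_def A2_def algebra_simps)
  have prods: "h ^ 2 * fps_const (c\<^sup>2) = 1" "h * fps_const c = 1" "h * fps_const (of_nat (k + l)) = k' + l'"
    "h * fps_const (a + b - 2) = p + q" "h ^ 2 * fps_const ((a - 1) * (b - 1)) = p * q"
    "h * fps_const (a + of_nat k + b + of_nat l) = u + v"
    "h ^ 2 * fps_const ((a + of_nat k) * (b + of_nat l)) = u * v"
    using c by (simp_all add: h_def p_def q_def k'_def l'_def u_def v_def power2_eq_square
        field_simps)
  have alg: "B = K2 + fps_X * (2 * B\<^sup>2 + h * (3 * B + 2 * B1) + 2 * P * B
      + h\<^sup>2 + h * P + Q - U * B - V)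
    - fps_X * (fps_X * (B ^ 3 + 3 * h * B * B1 + P * B\<^sup>2 + h\<^sup>2 * B2 + h * P * B1 + Q * B))"
    if "C2 * A = C2 * N
     + C * fps_X * (2 * A\<^sup>2 + 3 * A + 2 * A1 + 1 + E1 * (2 * A + 1)
          + E0 - D1 * A - D0)
     - fps_X\<^sup>2 * (A ^ 3 + 3 * A * A1 + A2 + E1 * (A\<^sup>2 + A1) + E0 * A)"
      "h\<^sup>2 * C2 = 1" "h * C = 1" "h * N = K2" "h * E1 = P" "h\<^sup>2 * E0 = Q" "h * D1 = U" "h\<^sup>2 * D0 = V"
    for K2 P Q U V C C2 N E1 E0 D1 D0
  proof -
    have "h ^ 3 * (C2 * A) = h * A * (h\<^sup>2 * C2)" by (simp add: power2_eq_square power3_eq_cube mult_ac)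
    also have "\<dots> = B" by (simp add: that B)
    finally have "B = h ^ 3 * (C2 * A)" ..
    also have "\<dots> = h\<^sup>2 * C2 * (h * N)
     + h * C * (fps_X * (2 * (h * A)\<^sup>2 + h * (3 * (h * A) + 2 * (h * A1)) + h\<^sup>2 + (h * E1) * (2 * (h * A) + h)
          + h\<^sup>2 * E0 - (h * D1) * (h * A) - h\<^sup>2 * D0))
     - fps_X * (fps_X * ((h * A) ^ 3 + 3 * h * (h * A) * (h * A1) + h\<^sup>2 * (h * A2)
         + h * E1 * ((h * A)\<^sup>2 + h * (h * A1)) + h\<^sup>2 * E0 * (h * A)))"
      unfolding that(1) by (simp add: algebra_simps power2_eq_square power3_eq_cube)
    also have "\<dots> = K2 + fps_X * (2 * B\<^sup>2 + h * (3 * B + 2 * B1) + h\<^sup>2 + P * (2 * B + h) + Q - U * B - V)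
       - fps_X * (fps_X * (B ^ 3 + 3 * h * B * B1 + h\<^sup>2 * B2 + P * (B\<^sup>2 + h * B1) + Q * B))"
      by (simp only: that(2-) B[symmetric] mult_1_left)
    finally show ?thesis by (simp only: algebra_simps)
  qed
  show ?thesis
    by (rule alg[OF power_sum_riccati[OF c T, folded A_def, folded A1_def, folded A2_def] prods])
qed

text \<open>Apart from its convergent constants, the right-hand side of the normalised equation is a
  multiple of \<open>fps_X\<close>. Hence convergence of \<open>m\<close> coefficients of
  \<open>B\<close> gives convergence of \<open>m + 1\<close> coefficients of the right-hand side,
  which is \<open>B\<close> again.\<close>

lemma power_sums_tendsto:
  fixes a b :: "nat \<Rightarrow> 'a::real_normed_field" and S :: "nat \<Rightarrow> 'a multiset"
  assumes T: "\<And>n. factorial_transform (\<Prod>s\<in>#S n. [:- s, 1:]) =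
      (\<Prod>m<k n. [:- (a n + of_nat m), 1:]) * (\<Prod>m<l n. [:- (b n + of_nat m), 1:])"
    and a: "(\<lambda>n. a n / of_nat n) \<longlonglongrightarrow> 0" and b: "(\<lambda>n. b n / of_nat n) \<longlonglongrightarrow> 0"
    and k: "(\<lambda>n. of_nat (k n) / of_nat n :: 'a) \<longlonglongrightarrow> 1 / 3"
    and l: "(\<lambda>n. of_nat (l n) / of_nat n :: 'a) \<longlonglongrightarrow> 1 / 3"
    and L: "L = fps_const (2 / 3) + fps_X * (2 * L\<^sup>2 - fps_const (2 / 3) * L - fps_const (1 / 9))
              - fps_X * (fps_X * L ^ 3)"
  shows "(\<lambda>n. (\<Sum>s\<in>#S n. (s / of_nat n) ^ j) / of_nat n) \<longlonglongrightarrow> L $ j"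
proof -
  define B where "B = (\<lambda>n. fps_const (1 / of_nat n) * power_sum_fps (S n) (of_nat n))"
  define B1 where "B1 = (\<lambda>n. - (fps_X * fps_deriv (B n)))"
  define B2 where "B2 = (\<lambda>n. - (fps_X * fps_deriv (B1 n)))"
  define h where "h = (\<lambda>n. fps_const (1 / of_nat n :: 'a))"
  define p where "p = (\<lambda>n. fps_const ((a n - 1) / of_nat n))"
  define q where "q = (\<lambda>n. fps_const ((b n - 1) / of_nat n))"
  define k' where "k' = (\<lambda>n. fps_const (of_nat (k n) / of_nat n :: 'a))"
  define l' where "l' = (\<lambda>n. fps_const (of_nat (l n) / of_nat n :: 'a))"
  define u where "u = (\<lambda>n. fps_const (a n / of_nat n + of_nat (k n) / of_nat n))"
  define v where "v = (\<lambda>n. fps_const (b n / of_nat n + of_nat (l n) / of_nat n))"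
  define rhs where "rhs = (\<lambda>n. k' n + l' n + fps_X * (2 * (B n)\<^sup>2 + h n * (3 * B n + 2 * B1 n)
      + 2 * (p n + q n) * B n + (h n)\<^sup>2 + h n * (p n + q n) + p n * q n - (u n + v n) * B n - u n * v n)
    - fps_X * (fps_X * (B n ^ 3 + 3 * h n * B n * B1 n + (p n + q n) * (B n)\<^sup>2 + (h n)\<^sup>2 * B2 n
        + h n * (p n + q n) * B1 n + p n * q n * B n)))"
  have eq: "B n = rhs n" if "n > 0" for n
    unfolding rhs_def B_def B1_def B2_def h_def p_def q_def k'_def l'_def u_def v_def
    by (rule normalised_riccati) (use that T in auto)
  have inv: "(\<lambda>n. 1 / of_nat n :: 'a) \<longlonglongrightarrow> 0" by (rule lim_1_over_n)
  have [fps_tendsto]: "fps_tendsto_upto m h (fps_const 0)" for m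
    unfolding h_def by (intro fps_tendsto inv)
  have [fps_tendsto]: "fps_tendsto_upto m p (fps_const 0)" for m
    unfolding p_def diff_divide_distrib by (intro fps_tendsto) (use tendsto_diff[OF a inv] in simp)
  have [fps_tendsto]: "fps_tendsto_upto m q (fps_const 0)" for m
    unfolding q_def diff_divide_distrib by (intro fps_tendsto) (use tendsto_diff[OF b inv] in simp)
  have [fps_tendsto]: "fps_tendsto_upto m k' (fps_const (1/3))" for m
    unfolding k'_def by (intro fps_tendsto k)
  have [fps_tendsto]: "fps_tendsto_upto m l' (fps_const (1/3))" for m
    unfolding l'_def by (intro fps_tendsto l)
  have [fps_tendsto]: "fps_tendsto_upto m u (fps_const (1/3))" for m
    unfolding u_def by (intro fps_tendsto) (use tendsto_add[OF a k] in simp)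
  have [fps_tendsto]: "fps_tendsto_upto m v (fps_const (1/3))" for m
    unfolding v_def by (intro fps_tendsto) (use tendsto_add[OF b l] in simp)
  have lim: "fps_tendsto_upto m B L" for m
  proof (induction m)
    case (Suc m)
    note [fps_tendsto] = Suc
    define L1 where "L1 = - (fps_X * fps_deriv L)"
    define L2 where "L2 = - (fps_X * fps_deriv L1)"
    have [fps_tendsto]: "fps_tendsto_upto m B1 L1"
      unfolding B1_def L1_def by (intro fps_tendsto)
    have [fps_tendsto]: "fps_tendsto_upto m B2 L2"
      unfolding B2_def L2_def by (intro fps_tendsto)
    let ?O = "fps_const 0 :: 'a fps" and ?t = "fps_const (1 / 3) :: 'a fps"
    have "fps_tendsto_upto (Suc m) rhs (?t + ?t + fps_X * (2 * L\<^sup>2 + ?O * (3 * L + 2 * L1)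
      + 2 * (?O + ?O) * L + ?O\<^sup>2 + ?O * (?O + ?O) + ?O * ?O - (?t + ?t) * L - ?t * ?t)
    - fps_X * (fps_X * (L ^ 3 + 3 * ?O * L * L1 + (?O + ?O) * L\<^sup>2 + ?O\<^sup>2 * L2
        + ?O * (?O + ?O) * L1 + ?O * ?O * L)))"
      unfolding rhs_def
      by (intro fps_tendsto_upto_add fps_tendsto_upto_diff fps_tendsto_upto_Suc_X_mult)
         (intro fps_tendsto)+
    also have "(?t + ?t + fps_X * (2 * L\<^sup>2 + ?O * (3 * L + 2 * L1)
      + 2 * (?O + ?O) * L + ?O\<^sup>2 + ?O * (?O + ?O) + ?O * ?O - (?t + ?t) * L - ?t * ?t)
    - fps_X * (fps_X * (L ^ 3 + 3 * ?O * L * L1 + (?O + ?O) * L\<^sup>2 + ?O\<^sup>2 * L2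
        + ?O * (?O + ?O) * L1 + ?O * ?O * L))) = L"
      by (rule trans[OF _ L[symmetric]]) simp
    finally have "fps_tendsto_upto (Suc m) rhs L" .
    moreover have "\<forall>\<^sub>F n in sequentially. rhs n $ i = B n $ i" for i
      using eventually_gt_at_top[of 0] by eventually_elim (simp add: eq)
    ultimately show ?case
      unfolding fps_tendsto_upto_def by (blast intro: Lim_transform_eventually)
  qed (simp add: fps_tendsto_upto_def)
  show ?thesis
    using fps_tendsto_uptoD[OF lim[of "Suc j"], of j] by (simp add: B_def power_sum_fps_def)
qed

section \<open>The limiting moments\<close>

text \<open>The limiting cubic \<open>u ^ 3 + x * (u + 1 / 3) ^ 2 = 0\<close> is linear in x, hence
  a rational curve. Setting \<open>u = - 1 / (3 * w)\<close> and \<open>x = 1 / X\<close> gives the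
  formula for \<open>fps_X\<close>, and \<open>w\<close> is the compositional inverse.\<close>

lemma fps_algebraic_parametrisation:
  obtains w :: "'a::field_char_0 fps"
  where "w $ 0 = 0" and "fps_X = 3 * w * (1 - w)\<^sup>2"
proof -
  define f where "f = 3 * fps_X * (1 - fps_X :: 'a fps)\<^sup>2"
  have f: "f $ 0 = 0" "f $ 1 = 3"
    by (simp_all add: f_def power2_eq_square mult.assoc numeral_fps_const)
  then have "f oo fps_inv f = fps_X" by (intro fps_inv_right) auto
  moreover have z: "fps_inv f $ 0 = 0" by (simp add: fps_inv_def)
  ultimately have "fps_X = 3 * fps_inv f * (1 - fps_inv f)\<^sup>2"
    by (simp add: f_def fps_compose_mult_distrib power2_eq_square fps_compose_sub_distrib)
  with z show ?thesis by (rule that)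
qed

lemma binomial_three_Suc:
  "(3 * Suc k choose Suc k) * ((k + 1) * (2 * k + 2) * (2 * k + 1)) =
   (3 * k choose k) * ((3 * k + 3) * (3 * k + 2) * (3 * k + 1))"
proof -
  have "fact k * fact (2 * k) * ((3 * Suc k choose Suc k) * ((k + 1) * (2 * k + 2) * (2 * k + 1))) =
      fact (Suc k) * fact (3 * Suc k - Suc k) * (3 * Suc k choose Suc k)"
    by (simp add: algebra_simps)
  also have "\<dots> = fact (3 * Suc k)" by (rule binomial_fact_lemma) simp
  also have "\<dots> = fact (3 * k) * ((3 * k + 3) * (3 * k + 2) * (3 * k + 1))"
    by (simp add: numeral_3_eq_3 algebra_simps)
  also have "fact (3 * k) = fact k * fact (3 * k - k) * (3 * k choose k)"
    by (rule binomial_fact_lemma[symmetric]) simp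
  finally show ?thesis by (simp only: mult.assoc) simp
qed

text \<open>With \<open>V = 1 / (1 - w)\<close> one has \<open>V = 1 + (X / 3) V\<^sup>3\<close> and \<open>L = (V + V\<^sup>2) / 3\<close>; the coefficients follow
  from the hypergeometric differential equation that \<open>L\<close> satisfies.\<close>
lemma limit_fps:
  obtains L :: "'a::field_char_0 fps"
  where "L = fps_const (2 / 3) + fps_X * (2 * L\<^sup>2 - fps_const (2 / 3) * L - fps_const (1 / 9))
              - fps_X * (fps_X * L ^ 3)"
    and "\<And>k. L $ k = 2 * of_nat ((3 * k) choose k) / (3 ^ Suc k * of_nat (Suc k))"
proof -
  obtain w :: "'a fps" where w0: "w $ 0 = 0" and X: "fps_X = 3 * w * (1 - w)\<^sup>2"
    by (rule fps_algebraic_parametrisation)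
  define V where "V = inverse (1 - w)"
  define Z where "Z = inverse (1 - 3 * w)"
  define W where "W = fps_deriv w"
  have V: "V * (1 - w) = 1"
    unfolding V_def by (rule inverse_mult_eq_1) (simp add: w0)
  have Z: "Z * (1 - 3 * w) = 1"
    unfolding Z_def by (rule inverse_mult_eq_1) (simp add: w0)
  define third where "third = fps_const (1 / 3 :: 'a)"
  have third: "3 * third = 1" by (simp add: third_def numeral_fps_const)
  have "fps_deriv fps_X = fps_deriv (3 * w * (1 - w)\<^sup>2)" using X by simp
  then have W: "3 * W * ((1 - w) * (1 - 3 * w)) = 1"
    by (simp add: W_def power2_eq_square algebra_simps)
  have W': "3 * W = V * Z" using W V Z by algebra
  have dV: "fps_deriv V = V\<^sup>2 * W"
  proof -
    have "fps_deriv (V * (1 - w)) = 0" using V by simp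
    then have "fps_deriv V * (1 - w) = V * W" by (simp add: W_def algebra_simps)
    then show ?thesis using V by algebra
  qed
  have dZ: "fps_deriv Z = 3 * Z\<^sup>2 * W"
  proof -
    have "fps_deriv (Z * (1 - 3 * w)) = 0" using Z by simp
    then have "fps_deriv Z * (1 - 3 * w) = 3 * Z * W" by (simp add: W_def algebra_simps)
    then show ?thesis using Z by algebra
  qed
  define L where "L = third * (V + V\<^sup>2)"
  have 3: "3 * L = V + V\<^sup>2" using third by (simp add: L_def flip: mult.assoc)
  show ?thesis
  proof (rule that[of L])
    have XV: "fps_X * V ^ 3 = 3 * (V - 1)" using X V by algebra
    have V0: "V \<noteq> 0" using V by auto
    have "9 * L = 6 + fps_X * (18 * L\<^sup>2 - 6 * L - 1) - 9 * fps_X * (fps_X * L ^ 3)"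
      
    proof -
      \<comment> \<open>\<open>fps_X\<close> occurs up to the second power, so \<open>V ^ 6\<close>
        provides enough factors to replace each \<open>fps_X * V ^ 3\<close> by
        \<open>3 * (V - 1)\<close>.\<close>
      have "V ^ 6 * (9 * L - (6 + fps_X * (18 * L\<^sup>2 - 6 * L - 1) - 9 * fps_X * (fps_X * L ^ 3))) = 0"
        using 3 XV by algebra
      with V0 show ?thesis by simp
    qed
    then show "L = fps_const (2 / 3) + fps_X * (2 * L\<^sup>2 - fps_const (2 / 3) * L - fps_const (1 / 9))
              - fps_X * (fps_X * L ^ 3)"
    proof -
      assume *: "9 * L = 6 + fps_X * (18 * L\<^sup>2 - 6 * L - 1) - 9 * fps_X * (fps_X * L ^ 3)"
      define c where "c = fps_const (1 / 9 :: 'a)"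
      have c: "c * 9 = 1" "c * 6 = fps_const (2 / 3)"
        by (simp_all add: c_def numeral_fps_const)
      have "L = c * (9 * L)" using c by (simp flip: mult.assoc)
      also have "\<dots> = c * 6 + fps_X * (2 * (c * 9) * L\<^sup>2 - c * 6 * L - c) - (c * 9) * fps_X * (fps_X * L ^ 3)"
        unfolding * by (simp add: algebra_simps)
      also have "\<dots> = fps_const (2 / 3) + fps_X * (2 * L\<^sup>2 - fps_const (2 / 3) * L - c)
              - fps_X * (fps_X * L ^ 3)"
        unfolding c by simp
      finally show ?thesis unfolding c_def .
    qed
    have dL: "3 * fps_deriv L = (1 + 2 * V) * V\<^sup>2 * W"
      using arg_cong[OF 3, of fps_deriv] by (simp add: dV power2_eq_square algebra_simps)
    define G1 where "G1 = fps_deriv L"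
    define G2 where "G2 = fps_deriv G1"
    have d1: "9 * G1 = (1 + 2 * V) * V ^ 3 * Z"
      using dL W' unfolding G1_def by algebra
    have "9 * G2 = (2 * V ^ 3 + 3 * V\<^sup>2 * (1 + 2 * V)) * Z * fps_deriv V + (1 + 2 * V) * V ^ 3 * fps_deriv Z"
      using arg_cong[OF d1, of fps_deriv] 
      by (simp add: G2_def power2_eq_square power3_eq_cube algebra_simps)
    then have d2: "27 * G2 = (2 * V ^ 3 + 3 * V\<^sup>2 * (1 + 2 * V)) * Z * (V ^ 3 * Z) + (1 + 2 * V) * V ^ 3 * (3 * Z ^ 3 * V)"
      unfolding dV dZ using W' by algebra
    \<comment> \<open>Read off from the expected ratio of consecutive coefficients. With \<theta> =
      X d/dX it says 6 (2 \<theta> - 1) (\<theta> + 1) L + 4 = 3 X (3 \<theta> + 1) (3 \<theta> + 2)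
      L; the 4 cancels the constant term, where \<open>L\<close> has the value 2/3.\<close>
    have ode: "2 * (2 * fps_X\<^sup>2 * G2 + 3 * fps_X * G1 - L) * 3 + 4 = 3 * fps_X * (9 * fps_X\<^sup>2 * G2 + 18 * fps_X * G1 + 2 * L)"
    proof -
      \<comment> \<open>Thus \<open>Z\<close> is \<open>V / (3 - 2 * V)\<close>. Multiplying by
        powers of \<open>V\<close> and of \<open>s = 3 - 2 * V\<close> clears all denominators and
        reduces the equation to a polynomial identity in \<open>V\<close>.\<close>
      have ZV: "Z * (3 - 2 * V) = V" using Z V by algebra
      have "(3 - 2 * V) $ 0 \<noteq> 0"
        using arg_cong[OF V, of "\<lambda>f :: 'a fps. f $ 0"] by (simp add: w0 numeral_fps_const)
      then have V32: "3 - 2 * V \<noteq> 0" by fastforce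
      define s where "s = 3 - 2 * V"
      have Zs: "Z * s = V" using ZV by (simp add: s_def)
      have "9 * (fps_X * G1) * s = (1 + 2 * V) * (fps_X * V ^ 3) * (Z * s)"
        using d1 by (simp add: mult_ac)
      then have P1: "9 * (fps_X * G1) * s = 3 * (V - 1) * (1 + 2 * V) * V"
        unfolding XV Zs by (simp only: mult_ac)
      have "27 * (fps_X\<^sup>2 * G2) * s ^ 3 = fps_X\<^sup>2 * (27 * G2) * s ^ 3"
        by (simp only: mult_ac)
      also have "\<dots> = fps_X\<^sup>2 * ((8 * V + 3) * V ^ 5 * ((Z * s)\<^sup>2 * s) + 3 * (1 + 2 * V) * V ^ 4 * (Z * s) ^ 3)"
        unfolding d2 by algebra
      also have "\<dots> = (fps_X * V ^ 3)\<^sup>2 * V * ((8 * V + 3) * s + 3 + 6 * V)"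
        unfolding Zs by algebra
      finally have P2: "27 * (fps_X\<^sup>2 * G2) * s ^ 3 = (3 * (V - 1))\<^sup>2 * V * ((8 * V + 3) * s + 3 + 6 * V)"
        unfolding XV .
      have "27 * V ^ 3 * s ^ 3 * (2 * (2 * fps_X\<^sup>2 * G2 + 3 * fps_X * G1 - L) * 3 + 4
          - 3 * fps_X * (9 * fps_X\<^sup>2 * G2 + 18 * fps_X * G1 + 2 * L)) =
          (12 * V ^ 3 - 27 * (fps_X * V ^ 3)) * (27 * (fps_X\<^sup>2 * G2) * s ^ 3)
          + (54 * V ^ 3 - 162 * (fps_X * V ^ 3)) * s\<^sup>2 * (9 * (fps_X * G1) * s)
          - (54 * V ^ 3 + 54 * (fps_X * V ^ 3)) * s ^ 3 * (3 * L) + 108 * V ^ 3 * s ^ 3"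
        by algebra
      also have "\<dots> = 0"
        unfolding P1 P2 XV 3 unfolding s_def by algebra
      finally have "27 * V ^ 3 * s ^ 3 * (2 * (2 * fps_X\<^sup>2 * G2 + 3 * fps_X * G1 - L) * 3 + 4
          - 3 * fps_X * (9 * fps_X\<^sup>2 * G2 + 18 * fps_X * G1 + 2 * L)) = 0" .
      with V0 V32 show ?thesis by (simp add: s_def)
    qed
    have rec: "2 * (2 * of_nat k + 1) * (of_nat k + 2) * L $ Suc k = (3 * of_nat k + 1) * (3 * of_nat k + 2) * L $ k" for k
    proof -
      have "(2 * (2 * fps_X\<^sup>2 * G2 + 3 * fps_X * G1 - L) * 3 + 4) $ Suc k =
          (3 * fps_X * (9 * fps_X\<^sup>2 * G2 + 18 * fps_X * G1 + 2 * L)) $ Suc k"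
        unfolding ode ..
      then have "3 * (2 * (2 * of_nat k + 1) * (of_nat k + 2) * L $ Suc k) =
          3 * ((3 * of_nat k + 1) * (3 * of_nat k + 2) * L $ k)"
        by (cases k) (simp_all add: G2_def G1_def numeral_fps_const mult.assoc power2_eq_square algebra_simps)
      then show ?thesis by simp
    qed
    show "L $ k = 2 * of_nat ((3 * k) choose k) / (3 ^ Suc k * of_nat (Suc k))" for k
    proof (induction k)
      case 0
      show ?case using arg_cong[OF 3, of "\<lambda>f :: 'a fps. f $ 0"] arg_cong[OF V, of "\<lambda>f :: 'a fps. f $ 0"] w0
        by (simp add: numeral_fps_const power2_eq_square field_simps)
    next
      case (Suc k)
      have nz: "2 * of_nat k + 1 \<noteq> (0::'a)" "of_nat k + 2 \<noteq> (0::'a)" "of_nat k + 1 \<noteq> (0::'a)"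
        by (metis of_nat_1 of_nat_add of_nat_eq_0_iff of_nat_mult of_nat_numeral add_is_0 one_neq_zero zero_neq_numeral)+
      define c d e x :: 'a where "c = of_nat (3 * k choose k)" and "d = of_nat (3 * Suc k choose Suc k)"
        and "e = 3 ^ Suc k" and "x = of_nat k"
      have nz: "2 * x + 1 \<noteq> 0" "x + 2 \<noteq> 0" "x + 1 \<noteq> 0" "e \<noteq> 0"
        using of_nat_neq_0[of "2 * k", where 'a = 'a] of_nat_neq_0[of "k + 1", where 'a = 'a]
          of_nat_neq_0[of k, where 'a = 'a] by (simp_all add: x_def e_def add_ac)
      have "d * ((x + 1) * (2 * x + 2) * (2 * x + 1)) = c * ((3 * x + 3) * (3 * x + 2) * (3 * x + 1))"
        using arg_cong[OF binomial_three_Suc[of k], of "of_nat :: nat \<Rightarrow> 'a"]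
        unfolding c_def d_def x_def by (simp only: of_nat_mult of_nat_add of_nat_numeral of_nat_1)
      then have "(x + 1) * (d * (2 * (x + 1) * (2 * x + 1)) - 3 * c * ((3 * x + 2) * (3 * x + 1))) = 0"
        by algebra
      then have d: "d * (2 * (x + 1) * (2 * x + 1)) = 3 * c * ((3 * x + 2) * (3 * x + 1))"
        using nz by simp
      have "of_nat (Suc k) = x + 1" by (simp add: x_def)
      then have "L $ k = 2 * c / (e * (x + 1))"
        unfolding Suc c_def e_def by (simp only:)
      then have "L $ k * (e * (x + 1)) = 2 * c"
        using nz by simp
      moreover have "2 * (2 * x + 1) * (x + 2) * L $ Suc k = (3 * x + 1) * (3 * x + 2) * L $ k"
        using rec[of k] by (simp add: x_def)
      ultimately have "2 * ((x + 1) * (2 * x + 1) * (L $ Suc k * (3 * e * (x + 2)) - 2 * d)) = 0"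
        using d by algebra
      then have "L $ Suc k * (3 * e * (x + 2)) = 2 * d" using nz by simp
      moreover have "3 * e * (x + 2) \<noteq> 0" using nz by simp
      ultimately have "L $ Suc k = 2 * d / (3 * e * (x + 2))" by (simp only: nonzero_eq_divide_eq simp_thms)
      moreover have "3 ^ Suc (Suc k) * of_nat (Suc (Suc k)) = 3 * e * (x + 2)"
        by (simp add: e_def x_def)
      ultimately show ?case unfolding d_def by simp
    qed
  qed
qed

section \<open>Beta integrals and the moments of the density\<close>

lemma Beta_one_third: "Beta (1 / 3) (2 / 3 :: real) = 2 * pi / sqrt 3"
proof -
  have "Gamma (complex_of_real (1 / 3)) * Gamma (complex_of_real (2 / 3)) =
      of_real pi / sin (of_real pi * complex_of_real (1 / 3))"
    using Gamma_reflection_complex[of "complex_of_real (1 / 3)"] by simp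
  moreover have "sin (of_real pi * complex_of_real (1 / 3)) = complex_of_real (sin (pi / 3))"
    by (simp flip: sin_of_real)
  ultimately have "complex_of_real (Gamma (1 / 3)) * complex_of_real (Gamma (2 / 3)) =
      of_real pi / complex_of_real (sin (pi / 3))"
    by (simp only: Gamma_complex_of_real)
  then have "complex_of_real (Gamma (1 / 3) * Gamma (2 / 3)) = complex_of_real (pi / sin (pi / 3))"
    by (simp only: of_real_mult of_real_divide)
  then have "Gamma (1 / 3) * Gamma (2 / 3) = pi / sin (pi / 3)"
    by (simp only: of_real_eq_iff)
  then show ?thesis
    by (simp add: Beta_def sin_60)
qed

text \<open>This is the triplication formula of the Gamma function at \<open>k + 1 / 3\<close>,
  divided by \<open>(2 * k)!\<close>. The induction raises both Beta arguments by one and compares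
  with the ratio of consecutive binomials.\<close>

lemma Beta_thirds:
  "9 ^ k * Beta (real k + 1 / 3) (real k + 2 / 3) = 2 * pi / sqrt 3 * (real (3 * k choose k) / 3 ^ k)"
proof (induction k)
  case 0
  show ?case by (simp add: Beta_one_third)
next
  case (Suc k)
  define x where "x = real k + 1 / 3"
  define y where "y = real k + 2 / 3"
  define c d where "c = real (3 * k choose k)" and "d = real (3 * Suc k choose Suc k)"
  have pos: "x > 0" "y > 0" by (simp_all add: x_def y_def)
  have "(x + y) * Beta (x + 1) y = x * Beta x y"
    by (rule Beta_plus1_left) (use pos in auto)
  moreover have "(x + 1 + y) * Beta (x + 1) (y + 1) = y * Beta (x + 1) y"
    by (rule Beta_plus1_right) (use pos in auto)
  moreover have "x + y = 2 * real k + 1" "x + 1 + y = 2 * real k + 2"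
    by (simp_all add: x_def y_def)
  ultimately have "Beta (x + 1) (y + 1) * ((2 * real k + 1) * (2 * real k + 2)) = x * y * Beta x y"
    by algebra
  moreover have "d * ((real k + 1) * (2 * real k + 2) * (2 * real k + 1)) =
      c * ((3 * real k + 3) * (3 * real k + 2) * (3 * real k + 1))"
    using arg_cong[OF binomial_three_Suc[of k], of real]
    unfolding c_def d_def by (simp only: of_nat_mult of_nat_add of_nat_numeral of_nat_1)
  then have "(real k + 1) * (d * ((2 * real k + 1) * (2 * real k + 2)) -
      3 * c * ((3 * real k + 2) * (3 * real k + 1))) = 0"
    by algebra
  then have "d * ((2 * real k + 1) * (2 * real k + 2)) = 3 * c * ((3 * real k + 2) * (3 * real k + 1))"
    by (simp add: add_eq_0_iff_both_eq_0)
  moreover have nz: "(2 * real k + 1) * (2 * real k + 2) \<noteq> 0" by simp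
  ultimately have "Beta (x + 1) (y + 1) = x * y * Beta x y / ((2 * real k + 1) * (2 * real k + 2))"
    and d: "d = 3 * c * ((3 * real k + 2) * (3 * real k + 1)) / ((2 * real k + 1) * (2 * real k + 2))"
    by (simp_all only: nonzero_eq_divide_eq simp_thms)
  then have "9 ^ Suc k * Beta (x + 1) (y + 1) =
      9 * (x * y) / ((2 * real k + 1) * (2 * real k + 2)) * (9 ^ k * Beta x y)"
    by (simp add: mult_ac)
  also have "9 ^ k * Beta x y = 2 * pi / sqrt 3 * (c / 3 ^ k)"
    unfolding x_def y_def c_def Suc ..
  also have "9 * (x * y) = (3 * real k + 2) * (3 * real k + 1)"
    by (simp add: x_def y_def algebra_simps)
  also have "(3 * real k + 2) * (3 * real k + 1) / ((2 * real k + 1) * (2 * real k + 2)) * (2 * pi / sqrt 3 * (c / 3 ^ k))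
      = 2 * pi / sqrt 3 * (d / 3 ^ Suc k)"
    unfolding d by (simp add: mult_ac)
  finally show ?case by (simp add: x_def y_def d_def add_ac)
qed

definition v_end :: real where "v_end = root 3 (9 / 4)"

lemma v_end_cube: "v_end ^ 3 = 9 / 4"
  by (simp add: v_end_def odd_real_root_pow)

lemma v_end_pos: "v_end > 0"
  by (simp add: v_end_def)

lemma cube_le_of_le_v_end: "0 \<le> x \<Longrightarrow> x \<le> v_end \<Longrightarrow> 4 * x ^ 3 \<le> 9"
  using power_mono[of x v_end 3] by (simp add: v_end_cube)

lemma continuous_on_a_fun [continuous_intros]: "continuous_on A a_fun"
  and continuous_on_b_fun [continuous_intros]: "continuous_on A b_fun"
  unfolding a_fun_def b_fun_def by (intro continuous_intros; simp)+

lemma continuous_on_v_fun [continuous_intros]: "continuous_on A v_fun"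
  unfolding v_fun_def by (intro continuous_intros)

lemma v_fun_nonneg:
  assumes "0 \<le> x" "x \<le> v_end"
  shows "v_fun x \<ge> 0"
proof -
  have s: "sqrt (9 - 4 * x ^ 3) \<le> 3"
    using assms by (intro real_le_lsqrt) (use cube_le_of_le_v_end in \<open>auto simp: power2_eq_square\<close>)
  then have "a_fun x \<ge> 0" "b_fun x \<ge> a_fun x"
    using cube_le_of_le_v_end[OF assms] by (auto simp: a_fun_def b_fun_def)
  with assms show ?thesis by (simp add: v_fun_def)
qed

text \<open>The factor \<open>1 - 2 * t\<close> is what the derivative of \<open>t * (1 - t)\<close>
  contributes when \<open>x ^ 3 = 9 * t * (1 - t)\<close> is substituted. The value is
  \<open>Beta a b - 2 * Beta (a + 1) b\<close>.\<close>

lemma has_integral_Beta_linear: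
  fixes a b :: real
  assumes "a > 0" "b > 0"
  shows "((\<lambda>t. t powr (a - 1) * (1 - t) powr (b - 1) * (1 - 2 * t)) has_integral
    (b - a) / (a + b) * Beta a b) {0..1}"
proof -
  have "((\<lambda>t. t powr (a - 1) * (1 - t) powr (b - 1) - 2 * (t powr (a + 1 - 1) * (1 - t) powr (b - 1)))
      has_integral Beta a b - 2 * Beta (a + 1) b) {0..1}"
    by (intro has_integral_diff has_integral_mult_right has_integral_Beta_real) (use assms in auto)
  moreover have "Beta a b - 2 * Beta (a + 1) b = (b - a) / (a + b) * Beta a b"
  proof -
    have "(a + b) * Beta (a + 1) b = a * Beta a b"
      by (rule Beta_plus1_left) (use assms in auto)
    then have "Beta (a + 1) b = a * Beta a b / (a + b)" using assms by (simp add: field_simps)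
    then show ?thesis using assms by (simp add: field_simps)
  qed
  ultimately have "((\<lambda>t. t powr (a - 1) * (1 - t) powr (b - 1) - 2 * (t powr (a + 1 - 1) * (1 - t) powr (b - 1)))
      has_integral (b - a) / (a + b) * Beta a b) {0..1}" by simp
  then show ?thesis
  proof (rule has_integral_spike[of "{0}", rotated 2])
    fix t :: real assume "t \<in> {0..1} - {0}"
    then have "t powr a = t * t powr (a - 1)" by (simp add: powr_diff)
    then show "t powr (a - 1) * (1 - t) powr (b - 1) * (1 - 2 * t) =
      t powr (a - 1) * (1 - t) powr (b - 1) - 2 * (t powr (a + 1 - 1) * (1 - t) powr (b - 1))"
      by (simp add: algebra_simps)
  qed simp
qed

text \<open>Substitute \<open>x\<^sup>3 = 9 t (1 - t)\<close>. For \<open>t \<le> 1/2\<close> the function \<open>b_fun\<close> becomes the cube root of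
  \<open>3 (1 - t)\<close>, and for \<open>t \<ge> 1/2\<close> the function \<open>a_fun\<close> does, so that the two halves of \<open>v_fun\<close>
  combine to a single integral of Beta type over \<open>[0, 1]\<close>.\<close>
lemma v_fun_moment_has_integral:
  "((\<lambda>x. v_fun x * x ^ (3 * k)) has_integral real (3 * k choose k) / (3 ^ Suc k * real (Suc k))) {0..v_end}"
proof -
  define C where "C = sqrt 3 / (4 * pi)"
  \<comment> \<open>Since \<open>(1 + x * (a + b)) * (b - a)\<close> equals
    \<open>(b + x * b ^ 2) - (a + x * a ^ 2)\<close>, the density is the difference of one
    expression evaluated at \<open>b_fun\<close> and at \<open>a_fun\<close>.\<close>
  define G where "G = (\<lambda>y x. C * (y x + x * (y x)\<^sup>2) * x ^ (3 * k) :: real)"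
  define g where "g = (\<lambda>t. root 3 (9 * t * (1 - t)))"
  define g' where "g' = (\<lambda>t. 3 * (1 - 2 * t) / (g t)\<^sup>2)"
  define R where "R = (\<lambda>t. root 3 (3 * (1 - t)))"
  define H where "H = (\<lambda>t. g' t * (C * (R t + g t * (R t)\<^sup>2) * g t ^ (3 * k)))"
  have g3: "g t ^ 3 = 9 * t * (1 - t)" for t by (simp add: g_def odd_real_root_pow)
  have sq: "sqrt (9 - 4 * g t ^ 3) = 3 * \<bar>1 - 2 * t\<bar>" for t
  proof -
    have "9 - 4 * g t ^ 3 = (3 * (1 - 2 * t))\<^sup>2"
      by (simp add: g3 power2_eq_square algebra_simps)
    then show ?thesis by (simp only: real_sqrt_abs abs_mult abs_numeral)
  qed
  have vals: "g 0 = 0" "g 1 = 0" "g (1 / 2) = v_end" by (simp_all add: g_def v_end_def)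
  have cont_g: "continuous_on A g" for A unfolding g_def by (intro continuous_intros)
  have range: "g t \<in> {0..v_end}" if "0 \<le> t" "t \<le> 1" for t
  proof -
    have "9 * t * (1 - t) \<le> 9 / 4" using sum_squares_ge_zero[of "1 - 2 * t" 0] by (simp add: algebra_simps power2_eq_square)
    then show ?thesis using that by (auto simp: g_def v_end_def)
  qed
  have deriv: "(g has_field_derivative g' t) (at t within A)" if "0 < t" "t < 1" for t A
  proof -
    have pos: "9 * t * (1 - t) > 0" using that by simp
    then have "(g has_field_derivative inverse (3 * root 3 (9 * t * (1 - t)) ^ (3 - Suc 0)) * (9 * (1 - 2 * t)))
        (at t within A)"
      unfolding g_def
      by (intro DERIV_chain'[where g = "root 3"])
         (auto intro!: derivative_eq_intros DERIV_real_root[of 3, simplified] simp: algebra_simps)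
    moreover have "inverse (3 * root 3 (9 * t * (1 - t)) ^ (3 - Suc 0)) * (9 * (1 - 2 * t)) = g' t"
      using pos by (simp add: g'_def g_def divide_simps)
    ultimately show ?thesis by simp
  qed
  have cont_G: "continuous_on A (G a_fun)" "continuous_on A (G b_fun)" for A
    unfolding G_def by (intro continuous_intros)+
  \<comment> \<open>The cube root \<open>g\<close> has no derivative at 0 and 1, hence the
    exceptional set. On this half \<open>g\<close> increases from 0 to \<open>v_end\<close>.\<close>
  have "((\<lambda>t. g' t *\<^sub>R G b_fun (g t)) has_integral
      (integral {g 0..g (1 / 2)} (G b_fun) - integral {g (1 / 2)..g 0} (G b_fun))) {0..1 / 2}"
    by (rule has_integral_substitution_general[of "{0, 1}" _ _ _ 0 v_end])
       (use range in \<open>auto intro!: cont_g cont_G deriv\<close>)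
  then have "((\<lambda>t. g' t * G b_fun (g t)) has_integral integral {0..v_end} (G b_fun)) {0..1 / 2}"
    using v_end_pos by (simp add: vals)
  moreover have "g' t * G b_fun (g t) = H t" if "t \<in> {0..1 / 2}" for t
  proof -
    have "b_fun (g t) = R t" using that unfolding b_fun_def sq R_def
      by (intro arg_cong[of _ _ "root 3"]) simp
    then show ?thesis by (simp add: H_def G_def)
  qed
  ultimately have 1: "(H has_integral integral {0..v_end} (G b_fun)) {0..1 / 2}"
    by (rule has_integral_eq[rotated])
  \<comment> \<open>Here \<open>g\<close> runs back from \<open>v_end\<close> to 0, which supplies
    the minus sign in front of the \<open>a_fun\<close> part.\<close>
  have "((\<lambda>t. g' t *\<^sub>R G a_fun (g t)) has_integral
      (integral {g (1 / 2)..g 1} (G a_fun) - integral {g 1..g (1 / 2)} (G a_fun))) {1 / 2..1}"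
    by (rule has_integral_substitution_general[of "{0, 1}" _ _ _ 0 v_end])
       (use range in \<open>auto intro!: cont_g cont_G deriv\<close>)
  then have "((\<lambda>t. g' t * G a_fun (g t)) has_integral - integral {0..v_end} (G a_fun)) {1 / 2..1}"
    using v_end_pos by (simp add: vals)
  moreover have "g' t * G a_fun (g t) = H t" if "t \<in> {1 / 2..1}" for t
  proof -
    have "a_fun (g t) = R t" using that unfolding a_fun_def sq R_def
      by (intro arg_cong[of _ _ "root 3"]) simp
    then show ?thesis by (simp add: H_def G_def)
  qed
  ultimately have 2: "(H has_integral - integral {0..v_end} (G a_fun)) {1 / 2..1}"
    by (rule has_integral_eq[rotated])
  have "(H has_integral integral {0..v_end} (G b_fun) + - integral {0..v_end} (G a_fun)) {0..1}"
    by (rule has_integral_combine[OF _ _ 1 2]) simp_all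
  also have "integral {0..v_end} (G b_fun) + - integral {0..v_end} (G a_fun) =
      integral {0..v_end} (\<lambda>x. G b_fun x - G a_fun x)"
    by (simp add: integral_diff integrable_continuous_real cont_G)
  also have "(\<lambda>x. G b_fun x - G a_fun x) = (\<lambda>x. v_fun x * x ^ (3 * k))"
    unfolding G_def v_fun_def C_def[symmetric] by (simp add: power2_eq_square algebra_simps)
  finally have int: "(H has_integral integral {0..v_end} (\<lambda>x. v_fun x * x ^ (3 * k))) {0..1}" .
  \<comment> \<open>The integrand \<open>H\<close> in terms of powers of \<open>t\<close> and
    \<open>1 - t\<close>: two Beta integrands, with parameters \<open>(k + 1/3, k + 2/3)\<close> and
    \<open>(k + 2/3, k + 4/3)\<close>. The second Beta value is a rational multiple of the
    first.\<close>
  define h where "h = (\<lambda>t::real. C * 9 ^ k *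
     (t powr (real k + 1 / 3 - 1) * (1 - t) powr (real k + 2 / 3 - 1) * (1 - 2 * t)
      + 3 * (t powr (real k + 2 / 3 - 1) * (1 - t) powr (real k + 4 / 3 - 1) * (1 - 2 * t))))"
  define B where "B = Beta (real k + 1 / 3) (real k + 2 / 3)"
  have "(h has_integral C * 9 ^ k *
     ((real k + 2 / 3 - (real k + 1 / 3)) / (real k + 1 / 3 + (real k + 2 / 3)) * B
      + 3 * ((real k + 4 / 3 - (real k + 2 / 3)) / (real k + 2 / 3 + (real k + 4 / 3)) *
          Beta (real k + 2 / 3) (real k + 4 / 3)))) {0..1}"
    unfolding h_def B_def
    by (intro has_integral_mult_right has_integral_add has_integral_Beta_linear) auto
  also have "C * 9 ^ k *
     ((real k + 2 / 3 - (real k + 1 / 3)) / (real k + 1 / 3 + (real k + 2 / 3)) * B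
      + 3 * ((real k + 4 / 3 - (real k + 2 / 3)) / (real k + 2 / 3 + (real k + 4 / 3)) *
          Beta (real k + 2 / 3) (real k + 4 / 3))) = C * (9 ^ k * B) * (2 / (3 * (real k + 1)))"
  proof -
    define x where "x = real k + 1"
    have x: "x > 0" "2 * x - 1 > 0" by (simp_all add: x_def)
    have "(real k + 1 / 3 + (real k + 2 / 3)) * Beta (real k + 1 / 3 + 1) (real k + 2 / 3) = (real k + 1 / 3) * B"
      unfolding B_def by (rule Beta_plus1_left) auto
    then have "(2 * x - 1) * Beta (real k + 2 / 3) (real k + 4 / 3) = (x - 2 / 3) * B"
      by (simp add: x_def Beta_commute[of "real k + 2 / 3"] add_ac)
    then have "Beta (real k + 2 / 3) (real k + 4 / 3) = (x - 2 / 3) * B / (2 * x - 1)"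
      using x by (simp add: field_simps)
    moreover have "C * 9 ^ k * (1 / 3 / (2 * x - 1) * B + 3 * (2 / 3 / (2 * x) * ((x - 2 / 3) * B / (2 * x - 1)))) =
        C * 9 ^ k * B * ((1 / 3 * x + (x - 2 / 3)) / (x * (2 * x - 1)))"
      using x by (simp add: divide_simps) (simp add: algebra_simps)
    moreover have "(1 / 3 * x + (x - 2 / 3)) / (x * (2 * x - 1)) = 2 / (3 * x)"
      using x by (simp add: field_simps)
    moreover have "(real k + 2 / 3 - (real k + 1 / 3)) / (real k + 1 / 3 + (real k + 2 / 3)) = 1 / 3 / (2 * x - 1)"
      "(real k + 4 / 3 - (real k + 2 / 3)) / (real k + 2 / 3 + (real k + 4 / 3)) = 2 / 3 / (2 * x)"
      by (simp_all add: x_def)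
    ultimately show ?thesis by (simp only: x_def[symmetric] mult.assoc)
  qed
  also have "\<dots> = real (3 * k choose k) / (3 ^ Suc k * real (Suc k))"
  proof -
    have "C * (2 * pi / sqrt 3) = 1 / 2" by (simp add: C_def)
    then have "C * (9 ^ k * B) = 1 / 2 * (real (3 * k choose k) / 3 ^ k)"
      unfolding B_def Beta_thirds by (simp only: flip: mult.assoc)
    moreover have "1 / 2 * (c / 3 ^ k) * (2 / (3 * (real k + 1))) = c / (3 ^ Suc k * real (Suc k))" for c
      by (simp add: add_ac)
    ultimately show ?thesis by (simp only:)
  qed
  finally have "(h has_integral real (3 * k choose k) / (3 ^ Suc k * real (Suc k))) {0..1}" .
  \<comment> \<open>The endpoints are left out because the cube roots of \<open>t\<close> and
    \<open>1 - t\<close> occur in denominators; they form a null set.\<close>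
  moreover have "H t = h t" if "t \<in> {0..1} - {0, 1}" for t
  proof -
    define T S w where "T = root 3 t" and "S = root 3 (1 - t)" and "w = root 3 (3::real)"
    have t: "0 < t" "t < 1" using that by auto
    have TS: "T > 0" "S > 0" "w > 0" "w ^ 3 = 3"
      using t by (simp_all add: T_def S_def w_def odd_real_root_pow)
    have "root 3 9 = w\<^sup>2" unfolding w_def by (simp flip: real_root_power)
    then have g: "g t = w\<^sup>2 * T * S" and R: "R t = w * S"
      unfolding g_def R_def real_root_mult by (simp_all add: T_def S_def w_def)
    have powr: "x powr (real k + 1 / 3 - 1) = x ^ k / (root 3 x)\<^sup>2"
      "x powr (real k + 2 / 3 - 1) = x ^ k / root 3 x"
      "x powr (real k + 4 / 3 - 1) = x ^ k * root 3 x" if "x > 0" for x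
    proof -
      have r: "root 3 x = x powr (1 / 3)" using that by (simp add: root_powr_inverse)
      have "x powr (real k + 1 / 3 - 1) = x powr (real k - 2 * (1 / 3))"
        "x powr (real k + 2 / 3 - 1) = x powr (real k - 1 / 3)"
        "x powr (real k + 4 / 3 - 1) = x powr (real k + 1 / 3)" by (simp_all add: algebra_simps)
      then show "x powr (real k + 1 / 3 - 1) = x ^ k / (root 3 x)\<^sup>2"
        "x powr (real k + 2 / 3 - 1) = x ^ k / root 3 x"
        "x powr (real k + 4 / 3 - 1) = x ^ k * root 3 x"
        using that unfolding r by (simp_all only: powr_diff powr_add powr_realpow mult_2 power2_eq_square)
    qed
    have gk: "g t ^ (3 * k) = 9 ^ k * (t ^ k * (1 - t) ^ k)"
      by (simp add: power_mult g3 power_mult_distrib)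
    have "H t = C * 9 ^ k * (t ^ k * (1 - t) ^ k) * (1 - 2 * t) * (3 * (R t + g t * (R t)\<^sup>2) / (g t)\<^sup>2)"
      unfolding H_def g'_def gk by (simp only: times_divide_eq_left times_divide_eq_right mult_ac)
    also have "3 * (R t + g t * (R t)\<^sup>2) / (g t)\<^sup>2 =
        3 * (w * S + w\<^sup>2 * T * S * (w * S)\<^sup>2) / (w\<^sup>2 * T * S)\<^sup>2"
      unfolding g R ..
    also have "3 * (w * S + w\<^sup>2 * T * S * (w * S)\<^sup>2) / (w\<^sup>2 * T * S)\<^sup>2 = 1 / (T\<^sup>2 * S) + 3 * S / T"
    proof -
      have "w ^ 4 = 3 * w" using TS(4) by (simp add: power4_eq_xxxx power3_eq_cube)
      moreover have "3 * (w * S + w\<^sup>2 * T * S * (w * S)\<^sup>2) * (T\<^sup>2 * S) =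
          (3 * w) * (T\<^sup>2 * S\<^sup>2) + 3 * w ^ 4 * T ^ 3 * S ^ 4"
        by algebra
      moreover have "w ^ 4 * (T\<^sup>2 * S\<^sup>2) + 3 * w ^ 4 * T ^ 3 * S ^ 4 = (1 + 3 * S\<^sup>2 * T) * (w\<^sup>2 * T * S)\<^sup>2"
        by algebra
      ultimately have "3 * (w * S + w\<^sup>2 * T * S * (w * S)\<^sup>2) * (T\<^sup>2 * S) = (1 + 3 * S\<^sup>2 * T) * (w\<^sup>2 * T * S)\<^sup>2"
        by simp
      then have "3 * (w * S + w\<^sup>2 * T * S * (w * S)\<^sup>2) / (w\<^sup>2 * T * S)\<^sup>2 = (1 + 3 * S\<^sup>2 * T) / (T\<^sup>2 * S)"
        using TS by (subst frac_eq_eq) auto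
      also have "\<dots> = 1 / (T\<^sup>2 * S) + 3 * S / T"
        using TS by (simp add: field_simps power2_eq_square)
      finally show ?thesis .
    qed
    also have "C * 9 ^ k * (t ^ k * (1 - t) ^ k) * (1 - 2 * t) * (1 / (T\<^sup>2 * S) + 3 * S / T) = h t"
    proof -
      have "h t = C * 9 ^ k * (t ^ k / T\<^sup>2 * ((1 - t) ^ k / S) * (1 - 2 * t)
          + 3 * (t ^ k / T * ((1 - t) ^ k * S) * (1 - 2 * t)))"
        using t by (simp only: h_def T_def S_def powr diff_gt_0_iff_gt)
      moreover have "c * (p / T\<^sup>2 * (q / S) * u + 3 * (p / T * (q * S) * u)) =
          c * (p * q) * u * (1 / (T\<^sup>2 * S) + 3 * S / T)" for c p q u
        using TS by (simp add: field_simps)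
      ultimately show ?thesis by (simp only:)
    qed
    finally show ?thesis .
  qed
  ultimately have "(H has_integral real (3 * k choose k) / (3 ^ Suc k * real (Suc k))) {0..1}"
    by (intro has_integral_spike[of "{0,1}" "{0..1}" H h]) auto
  with int have "integral {0..v_end} (\<lambda>x. v_fun x * x ^ (3 * k)) = real (3 * k choose k) / (3 ^ Suc k * real (Suc k))"
    using has_integral_unique by blast
  moreover have "(\<lambda>x. v_fun x * x ^ (3 * k)) integrable_on {0..v_end}"
    by (intro integrable_continuous_real continuous_intros)
  ultimately show ?thesis by (simp add: has_integral_iff)
qed

section \<open>Diagonal polynomials\<close>

definition cubic_moment :: "nat \<Rightarrow> real" where
  "cubic_moment k = (LBINT t:{0..}. t ^ k * exp (- (t ^ 3)))"

lemma set_integrable_cubic_weight: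
  "set_integrable lborel {0..} (\<lambda>t::real. t ^ k * exp (- (t ^ 3)))"
proof -
  have "integrable lborel (\<lambda>t::real. t ^ k * exp (- t) * indicator {0..} t)"
  proof (rule integrableI_nn_integral_finite[where x = "real_of_nat (fact k)"])
    show "(\<integral>\<^sup>+ t. ennreal (t ^ k * exp (- t) * indicator {0..} t) \<partial>lborel) = ennreal (real_of_nat (fact k))"
      using nn_intergal_power_times_exp_Ici[of k]
      by (simp add: ennreal_mult' ennreal_indicator flip: nn_integral_set_ennreal)
  qed (auto simp: indicator_def)
  then have "integrable lborel (\<lambda>t::real. exp 1 * (t ^ k * exp (- t) * indicator {0..} t))"
    by simp
  then have "integrable lborel (\<lambda>t::real. indicator {0..} t *\<^sub>R (t ^ k * exp (- (t ^ 3))))"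
  proof (rule Bochner_Integration.integrable_bound)
    show "AE t in lborel. norm (indicator {0..} (t::real) *\<^sub>R (t ^ k * exp (- (t ^ 3)))) \<le>
        norm (exp 1 * (t ^ k * exp (- t) * indicator {0..} t))"
    proof (intro AE_I2)
      fix t :: real
      have "exp (- (t ^ 3)) \<le> exp 1 * exp (- t)" if "t \<ge> 0"
      proof -
        have "t - t ^ 3 \<le> 1"
        proof (cases "t \<le> 1")
          case True
          then show ?thesis using that zero_le_power[of t 3] by linarith
        next
          case False
          then show ?thesis using self_le_power[of t 3] by simp
        qed
        then show ?thesis by (simp flip: exp_add)
      qed
      then show "norm (indicator {0..} t *\<^sub>R (t ^ k * exp (- (t ^ 3)))) \<le>
          norm (exp 1 * (t ^ k * exp (- t) * indicator {0..} t))"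
        using mult_left_mono[of "exp (- (t ^ 3))" "exp 1 * exp (- t)" "t ^ k"]
        by (auto simp: indicator_def abs_mult mult_ac)
    qed
  qed simp
  then show ?thesis by (simp add: set_integrable_def)
qed

lemma cubic_moment_pos: "cubic_moment k > 0"
proof -
  have "0 < (LBINT t:{1..2::real}. exp (- 8 :: real))"
    by (simp add: set_lebesgue_integral_def)
  also have "\<dots> \<le> cubic_moment k"
    unfolding cubic_moment_def set_lebesgue_integral_def
  proof (rule integral_mono)
    show "integrable lborel (\<lambda>t. indicator {1..2::real} t *\<^sub>R exp (- 8 :: real))" by simp
    show "integrable lborel (\<lambda>t::real. indicator {0..} t *\<^sub>R (t ^ k * exp (- (t ^ 3))))"
      using set_integrable_cubic_weight by (simp add: set_integrable_def)
    show "indicator {1..2::real} t *\<^sub>R exp (- 8 :: real) \<le> indicator {0..} t *\<^sub>R (t ^ k * exp (- (t ^ 3)))" for t :: real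
    proof (cases "t \<in> {1..2}")
      case True
      then have "exp (- 8) \<le> exp (- (t ^ 3))" using power_mono[of t 2 3] by simp
      moreover have "1 \<le> t ^ k" using True by simp
      ultimately have "1 * exp (- 8) \<le> t ^ k * exp (- (t ^ 3))" by (intro mult_mono) auto
      with True show ?thesis by simp
    qed (auto simp: indicator_def)
  qed
  finally show ?thesis .
qed

text \<open>Integrate the derivative of \<open>t ^ (k + 1) * exp (- (t ^ 3))\<close>, which vanishes
  at both ends. As \<open>cubic_moment k\<close> is Gamma((k + 1) / 3) / 3, this is the functional
  equation of Gamma.\<close>

lemma cubic_moment_add_3: "cubic_moment (k + 3) = (real k + 1) / 3 * cubic_moment k"
proof -
  define w where "w = (\<lambda>k t. t ^ k * exp (- (t ^ 3)) :: real)"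
  define f where "f = (\<lambda>t. (real k + 1) * w k t - 3 * w (k + 3) t)"
  have Ioi: "(LBINT t:{0..}. g t) = (LBINT t:{0<..}. g t)" for g :: "real \<Rightarrow> real"
    by (rule set_integral_discrete_difference[where X = "{0}"]) auto
  have int: "set_integrable lborel {0..} (w k)" for k
    unfolding w_def by (rule set_integrable_cubic_weight)
  then have int': "set_integrable lborel {0<..} (w k)" for k
    by (rule set_integrable_subset) auto
  have "(LBINT t=ereal 0..\<infinity>. f t) = 0 - 0"
  proof (rule interval_integral_FTC_integrable[where F = "w (k + 1)"])
    show "(w (k + 1) has_vector_derivative f t) (at t)" for t
    proof -
      have "(w (k + 1) has_field_derivative (real k + 1) * t ^ k * exp (- (t ^ 3)) +
          (exp (- (t ^ 3)) * - (3 * t\<^sup>2)) * t ^ (k + 1)) (at t)"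
        unfolding w_def
      proof (rule DERIV_mult)
        show "((\<lambda>t. t ^ (k + 1)) has_field_derivative (real k + 1) * t ^ k) (at t)"
          using DERIV_pow[of "k + 1" t UNIV] by (simp add: add_ac)
        show "((\<lambda>t. exp (- (t ^ 3))) has_field_derivative exp (- (t ^ 3)) * - (3 * t\<^sup>2)) (at t)"
          by (auto intro!: derivative_eq_intros)
      qed
      then show ?thesis
        unfolding w_def f_def has_real_derivative_iff_has_vector_derivative[symmetric]
        by (rule DERIV_cong) (simp add: algebra_simps power_add power2_eq_square power3_eq_cube)
    qed
    show "isCont f t" for t unfolding f_def w_def by (intro continuous_intros)
    show "set_integrable lborel (einterval (ereal 0) \<infinity>) f"
      unfolding f_def using int' by (intro set_integral_diff set_integrable_mult_right) auto
    have "(w (k + 1) \<longlongrightarrow> w (k + 1) 0) (at_right 0)"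
      unfolding w_def by (intro tendsto_intros)
    then show "((w (k + 1) \<circ> real_of_ereal) \<longlongrightarrow> 0) (at_right (ereal 0))"
      unfolding ereal_tendsto_simps by (simp add: w_def)
    have "(w (k + 1) \<longlongrightarrow> 0) at_top" unfolding w_def by real_asymp
    then show "((w (k + 1) \<circ> real_of_ereal) \<longlongrightarrow> 0) (at_left \<infinity>)"
      unfolding ereal_tendsto_simps .
  qed simp
  then have "(LBINT t:{0<..}. f t) = 0"
    by (simp add: interval_integral_to_infinity_eq)
  moreover have "(LBINT t:{0<..}. f t) = (real k + 1) * (LBINT t:{0<..}. w k t) - 3 * (LBINT t:{0<..}. w (k + 3) t)"
    unfolding f_def using int' by (subst set_integral_diff) auto
  ultimately show ?thesis
    by (simp add: cubic_moment_def Ioi w_def field_simps)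
qed

section \<open>Integrals along the three rays\<close>

lemma omega_cube: "omega ^ 3 = 1"
proof -
  have "omega ^ 3 = exp (of_nat 3 * (2 * of_real pi * \<i> / 3))"
    unfolding omega_def by (rule exp_of_nat_mult[symmetric])
  also have "of_nat 3 * (2 * of_real pi * \<i> / 3) = 2 * complex_of_real pi * \<i>" by simp
  also have "exp \<dots> = 1" by (rule exp_two_pi_i)
  finally show ?thesis .
qed

lemma omega_eq: "omega = Complex (- 1 / 2) (sqrt 3 / 2)"
proof -
  have "omega = cis (2 * pi / 3)" by (simp add: omega_def cis_conv_exp mult_ac)
  also have "\<dots> = Complex (- 1 / 2) (sqrt 3 / 2)"
    by (rule complex_eqI) (simp_all add: cos_120 sin_120)
  finally show ?thesis .
qed

lemma omega_sum: "1 + omega + omega\<^sup>2 = 0"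
  by (simp add: omega_eq complex_eq_iff power2_eq_square)

lemma omega_neq_1: "omega \<noteq> 1"
  by (simp add: omega_eq complex_eq_iff)

text \<open>On all three rays the weight is the same function of the radius because
  \<open>(c * t) ^ 3 = t ^ 3\<close>; the direction enters only through powers of
  \<open>c\<close>.\<close>

lemma set_integral_ray:
  fixes c :: complex
  assumes "c ^ 3 = 1"
  shows "(LBINT t:{0..}. (c * of_real t) ^ i * poly p (c * of_real t) * exp (- ((c * of_real t) ^ 3))) =
    (\<Sum>k\<le>degree p. coeff p k * c ^ (k + i) * of_real (cubic_moment (k + i)))"
proof -
  have integrand: "(c * of_real t) ^ i * poly p (c * of_real t) * exp (- ((c * of_real t) ^ 3)) =
      (\<Sum>k\<le>degree p. coeff p k * c ^ (k + i) * of_real (t ^ (k + i) * exp (- (t ^ 3))))" for t :: real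
    by (simp add: poly_altdef power_mult_distrib assms sum_distrib_left sum_distrib_right power_add mult_ac
        flip: exp_of_real)
  have int: "integrable lborel (\<lambda>t. indicator {0..} t *\<^sub>R complex_of_real (t ^ k * exp (- (t ^ 3))))" for k
    using set_integrable_cubic_weight[of k] unfolding set_integrable_def
    by (drule_tac integrable_of_real[where 'a = complex]) (simp add: scaleR_conv_of_real)
  have val: "(LBINT t. indicator {0..} t *\<^sub>R complex_of_real (t ^ k * exp (- (t ^ 3)))) = of_real (cubic_moment k)" for k
    using set_integral_complex_of_real[of lborel "{0..}" "\<lambda>t. t ^ k * exp (- (t ^ 3))"]
    by (simp add: cubic_moment_def set_lebesgue_integral_def)
  have "(LBINT t:{0..}. (c * of_real t) ^ i * poly p (c * of_real t) * exp (- ((c * of_real t) ^ 3))) =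
     (LBINT t. (\<Sum>k\<le>degree p. coeff p k * c ^ (k + i) *
        (indicator {0..} t *\<^sub>R complex_of_real (t ^ (k + i) * exp (- (t ^ 3))))))"
    unfolding set_lebesgue_integral_def integrand by (simp add: scaleR_sum_right)
  also have "\<dots> = (\<Sum>k\<le>degree p. coeff p k * c ^ (k + i) * of_real (cubic_moment (k + i)))"
    using int by (subst Bochner_Integration.integral_sum) (simp_all only: integral_mult_right_zero val integrable_mult_right)
  finally show ?thesis .
qed

lemma ray_integral_eq:
  "ray_integral j (\<lambda>x. x ^ i * poly p x * exp (- (x ^ 3))) =
   (\<Sum>k\<le>degree p. (1 - omega ^ (j * (k + i + 1))) * (coeff p k * of_real (cubic_moment (k + i))))"
proof -
  have "(omega ^ j) ^ 3 = 1"
    by (metis omega_cube power_mult mult.commute power_one)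
  from set_integral_ray[OF this, of i p] set_integral_ray[of 1 i p]
  have "ray_integral j (\<lambda>x. x ^ i * poly p x * exp (- (x ^ 3))) =
      (\<Sum>k\<le>degree p. coeff p k * of_real (cubic_moment (k + i))) -
      omega ^ j * (\<Sum>k\<le>degree p. coeff p k * (omega ^ j) ^ (k + i) * of_real (cubic_moment (k + i)))"
    by (simp add: ray_integral_def)
  also have "\<dots> = (\<Sum>k\<le>degree p. (1 - omega ^ (j * (k + i + 1))) * (coeff p k * of_real (cubic_moment (k + i))))"
    unfolding sum_distrib_left sum_subtractf[symmetric]
    by (intro sum.cong refl) (simp add: algebra_simps power_add flip: power_mult)
  finally show ?thesis .
qed

text \<open>Passing from \<open>q\<close> to \<open>q + 1\<close> raises \<open>s\<close> by 3 and
  hence \<open>(s + 1) / 3\<close> by 1. This is the shift built into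
  \<open>factorial_transform\<close>, and the moment recursion supplies its factor
  \<open>X\<close>.\<close>

lemma cubic_moment_sum:
  "(\<Sum>q\<le>degree p. coeff p q * of_real (cubic_moment (3 * q + s))) =
     complex_of_real (cubic_moment s) * poly (factorial_transform p) ((of_nat s + 1) / 3)"
proof (induction p arbitrary: s)
  case (pCons a p)
  have "(\<Sum>q\<le>degree (pCons a p). coeff (pCons a p) q * of_real (cubic_moment (3 * q + s))) =
      a * of_real (cubic_moment s) + (\<Sum>q\<le>degree p. coeff p q * of_real (cubic_moment (3 * q + (s + 3))))"
    by (cases "p = 0") (simp_all add: sum.atMost_Suc_shift add_ac del: sum.atMost_Suc)
  also have "\<dots> = complex_of_real (cubic_moment s) * poly (factorial_transform (pCons a p)) ((of_nat s + 1) / 3)"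
    unfolding pCons.IH cubic_moment_add_3 factorial_transform_pCons
    by (simp add: poly_pcompose field_simps)
  finally show ?case .
qed simp

section \<open>Splitting the exponents modulo 3\<close>

text \<open>The polynomial \<open>p\<close> is the sum of \<open>x ^ r\<close> times its section
  \<open>r\<close> at \<open>x ^ 3\<close>, over \<open>r < 3\<close>. The summation bound is
  generous; all surplus coefficients are 0.\<close>

definition poly_section :: "nat \<Rightarrow> 'a::comm_monoid_add poly \<Rightarrow> 'a poly" where
  "poly_section r p = (\<Sum>q\<le>degree p. monom (coeff p (3 * q + r)) q)"

lemma coeff_poly_section [simp]: "coeff (poly_section r p) q = coeff p (3 * q + r)"
proof -
  have "coeff (poly_section r p) q = (\<Sum>q'\<le>degree p. if q' = q then coeff p (3 * q' + r) else 0)"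
    by (simp add: poly_section_def coeff_sum)
  also have "\<dots> = coeff p (3 * q + r)"
    by (simp add: sum.delta coeff_eq_0)
  finally show ?thesis .
qed

lemma poly_section_diff: "poly_section r (p - q) = poly_section r p - poly_section r (q :: 'a::ab_group_add poly)"
  by (rule poly_eqI) simp

lemma poly_eq_0_if_sections:
  assumes "\<And>r. r < 3 \<Longrightarrow> poly_section r p = 0"
  shows "p = 0"
proof (rule poly_eqI)
  fix m
  have "coeff (poly_section (m mod 3) p) (m div 3) = 0" using assms by simp
  then show "coeff p m = coeff 0 m" by (simp add: mult.commute)
qed

lemma omega_power_eq:
  assumes "m mod 3 = m' mod 3"
  shows "omega ^ m = omega ^ m'"
proof -
  have "omega ^ m = omega ^ (m mod 3)" for m
  proof -
    have "omega ^ m = (omega ^ 3) ^ (m div 3) * omega ^ (m mod 3)"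
      by (simp flip: power_mult power_add)
    then show ?thesis by (simp add: omega_cube)
  qed
  with assms show ?thesis by metis
qed

lemma sum_lessThan_mult_3:
  "(\<Sum>k<3 * n. f k) = (\<Sum>r<3. \<Sum>q<n. f (3 * q + r :: nat) :: 'a::comm_monoid_add)"
proof -
  have "(\<Sum>k<3 * n. f k) = (\<Sum>q<n. \<Sum>r<3. f (3 * q + r))"
    by (induction n) (simp_all add: eval_nat_numeral add_ac)
  then show ?thesis by (subst sum.swap)
qed

text \<open>The power of \<open>omega\<close> depends only on the exponent modulo 3, so it is
  constant on each section and can be taken out of the sum.\<close>

lemma ray_integral_sections:
  "ray_integral j (\<lambda>x. x ^ i * poly p x * exp (- (x ^ 3))) =
   (\<Sum>r<3. (1 - omega ^ (j * (r + i + 1))) * (of_real (cubic_moment (r + i)) *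
      poly (factorial_transform (poly_section r p)) ((of_nat (r + i) + 1) / 3)))"
proof -
  define g where "g = (\<lambda>k. coeff p k * complex_of_real (cubic_moment (k + i)))"
  have g0: "g k = 0" if "k > degree p" for k using that by (simp add: g_def coeff_eq_0)
  have "ray_integral j (\<lambda>x. x ^ i * poly p x * exp (- (x ^ 3))) =
      (\<Sum>k\<le>degree p. (1 - omega ^ (j * (k + i + 1))) * g k)"
    by (simp add: ray_integral_eq g_def)
  also have "\<dots> = (\<Sum>k<3 * Suc (degree p). (1 - omega ^ (j * (k + i + 1))) * g k)"
    by (rule sum.mono_neutral_left) (auto simp: g0)
  also have "\<dots> = (\<Sum>r<3. \<Sum>q<Suc (degree p). (1 - omega ^ (j * (3 * q + r + i + 1))) * g (3 * q + r))"
    by (rule sum_lessThan_mult_3)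
  also have "\<dots> = (\<Sum>r<3. (1 - omega ^ (j * (r + i + 1))) * (\<Sum>q<Suc (degree p). g (3 * q + r)))"
    unfolding sum_distrib_left
  proof (intro sum.cong refl)
    fix r q
    have "j * (3 * q + r + i + 1) mod 3 = j * (r + i + 1) mod 3"
    proof -
      have "j * (3 * q + r + i + 1) = j * (r + i + 1) + 3 * (j * q)" by (simp add: algebra_simps)
      then show ?thesis by (simp only: mod_mult_self2)
    qed
    then have "omega ^ (j * (3 * q + r + i + 1)) = omega ^ (j * (r + i + 1))"
      by (rule omega_power_eq)
    then show "(1 - omega ^ (j * (3 * q + r + i + 1))) * g (3 * q + r) =
        (1 - omega ^ (j * (r + i + 1))) * g (3 * q + r)"
      by (simp only:)
  qed
  finally have "ray_integral j (\<lambda>x. x ^ i * poly p x * exp (- (x ^ 3))) =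
      (\<Sum>r<3. (1 - omega ^ (j * (r + i + 1))) * (\<Sum>q<Suc (degree p). g (3 * q + r)))" .
  moreover have "(\<Sum>q<Suc (degree p). g (3 * q + r)) = of_real (cubic_moment (r + i)) *
      poly (factorial_transform (poly_section r p)) ((of_nat (r + i) + 1) / 3)" for r
  proof -
    have "coeff (poly_section r p) q = 0" if "q > degree p" for q
      using that by (simp add: coeff_eq_0)
    then have "degree (poly_section r p) \<le> degree p" by (rule degree_le[rule_format])
    then have "(\<Sum>q<Suc (degree p). g (3 * q + r)) = (\<Sum>q\<le>degree (poly_section r p). g (3 * q + r))"
      by (intro sum.mono_neutral_right)
         (auto simp: g_def simp flip: coeff_poly_section intro!: coeff_eq_0)
    also have "\<dots> = (\<Sum>q\<le>degree (poly_section r p).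
        coeff (poly_section r p) q * of_real (cubic_moment (3 * q + (r + i))))"
      by (simp add: g_def add_ac)
    finally show ?thesis by (simp only: cubic_moment_sum)
  qed
  ultimately show ?thesis by (simp only:)
qed

text \<open>Division by \<open>1 - omega\<close>, using \<open>1 + omega = - omega ^ 2\<close>,
  gives \<open>x = omega ^ 2 * y\<close> and \<open>y = omega ^ 2 * x\<close>. Hence
  \<open>x = omega * x\<close>, which forces \<open>x = 0\<close>.\<close>

lemma omega_system:
  assumes "(1 - omega) * x + (1 - omega\<^sup>2) * y = 0" "(1 - omega\<^sup>2) * x + (1 - omega) * y = 0"
  shows "x = 0 \<and> y = 0"
proof -
  have "(1 - omega) * (x - omega\<^sup>2 * y) = 0" "(1 - omega) * (y - omega\<^sup>2 * x) = 0"
    using assms omega_sum by algebra+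
  then have xy: "x = omega\<^sup>2 * y" "y = omega\<^sup>2 * x" using omega_neq_1 by auto
  then have "(1 - omega) * x = 0" using omega_cube by algebra
  then have "x = 0" using omega_neq_1 by simp
  with xy show ?thesis by simp
qed

text \<open>For each \<open>i\<close> exactly one residue \<open>r\<close> makes
  \<open>r + i + 1\<close> divisible by 3, and its coefficient vanishes for both \<open>j\<close>.
  The other two residues form the nonsingular system of \<open>omega_system\<close>, so the
  conditions on the sections decouple.\<close>

lemma omega_sums_vanish_iff:
  "(\<forall>j\<in>{1, 2}. (\<Sum>r<3. (1 - omega ^ (j * (r + i + 1))) * W r) = 0) \<longleftrightarrow>
   (\<forall>r<3. \<not> 3 dvd (r + i + 1) \<longrightarrow> W r = 0)"
proof -
  have ball2: "(\<forall>j\<in>{1, 2}. \<Phi> j) \<longleftrightarrow> \<Phi> 1 \<and> \<Phi> 2" for \<Phi> :: "nat \<Rightarrow> bool" by auto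
  have all3: "(\<forall>r<3. \<Phi> r) \<longleftrightarrow> \<Phi> 0 \<and> \<Phi> 1 \<and> \<Phi> 2" for \<Phi> :: "nat \<Rightarrow> bool"
    by (auto simp: eval_nat_numeral less_Suc_eq)
  have sum3: "(\<Sum>r<3. F r) = F 0 + F 1 + F 2" for F :: "nat \<Rightarrow> complex"
    by (simp add: eval_nat_numeral)
  define w where "w = omega\<^sup>2"
  have pw: "m mod 3 = 0 \<Longrightarrow> omega ^ m = 1" "m mod 3 = 1 \<Longrightarrow> omega ^ m = omega"
    "m mod 3 = 2 \<Longrightarrow> omega ^ m = w" for m
    using omega_power_eq[of m 0] omega_power_eq[of m 1] omega_power_eq[of m 2] by (simp_all add: w_def)
  have "i mod 3 = 0 \<or> i mod 3 = 1 \<or> i mod 3 = 2" by auto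
  then show ?thesis
  proof (elim disjE)
    assume i: "i mod 3 = 0"
    have m: "1 * (0 + i + 1) mod 3 = 1"
      "1 * (1 + i + 1) mod 3 = 2"
      "1 * (2 + i + 1) mod 3 = 0"
      "2 * (0 + i + 1) mod 3 = 2"
      "2 * (1 + i + 1) mod 3 = 1"
      "2 * (2 + i + 1) mod 3 = 0"
      using i by presburger+
    have e: "omega ^ (1 * (0 + i + 1)) = omega"
      "omega ^ (1 * (1 + i + 1)) = w"
      "omega ^ (1 * (2 + i + 1)) = 1"
      "omega ^ (2 * (0 + i + 1)) = w"
      "omega ^ (2 * (1 + i + 1)) = omega"
      "omega ^ (2 * (2 + i + 1)) = 1"
      by (simp_all only: pw m)
    have d: "3 dvd (0 + i + 1) \<longleftrightarrow> False" "3 dvd (1 + i + 1) \<longleftrightarrow> False" "3 dvd (2 + i + 1) \<longleftrightarrow> True"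
      using i by presburger+
    have "(1 - omega) * W 0 + (1 - w) * W 1 = 0 \<and> (1 - w) * W 0 + (1 - omega) * W 1 = 0 \<longleftrightarrow>
        W 0 = 0 \<and> W 1 = 0"
      using omega_system[of "W 0" "W 1"] by (auto simp: w_def)
    then show ?thesis
      unfolding ball2 all3 sum3 e d by (auto simp: add.commute)
  next
    assume i: "i mod 3 = 1"
    have m: "1 * (0 + i + 1) mod 3 = 2"
      "1 * (1 + i + 1) mod 3 = 0"
      "1 * (2 + i + 1) mod 3 = 1"
      "2 * (0 + i + 1) mod 3 = 1"
      "2 * (1 + i + 1) mod 3 = 0"
      "2 * (2 + i + 1) mod 3 = 2"
      using i by presburger+
    have e: "omega ^ (1 * (0 + i + 1)) = w"
      "omega ^ (1 * (1 + i + 1)) = 1"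
      "omega ^ (1 * (2 + i + 1)) = omega"
      "omega ^ (2 * (0 + i + 1)) = omega"
      "omega ^ (2 * (1 + i + 1)) = 1"
      "omega ^ (2 * (2 + i + 1)) = w"
      by (simp_all only: pw m)
    have d: "3 dvd (0 + i + 1) \<longleftrightarrow> False" "3 dvd (1 + i + 1) \<longleftrightarrow> True" "3 dvd (2 + i + 1) \<longleftrightarrow> False"
      using i by presburger+
    have "(1 - omega) * W 2 + (1 - w) * W 0 = 0 \<and> (1 - w) * W 2 + (1 - omega) * W 0 = 0 \<longleftrightarrow>
        W 2 = 0 \<and> W 0 = 0"
      using omega_system[of "W 2" "W 0"] by (auto simp: w_def)
    then show ?thesis
      unfolding ball2 all3 sum3 e d by (auto simp: add.commute)
  next
    assume i: "i mod 3 = 2"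
    have m: "1 * (0 + i + 1) mod 3 = 0"
      "1 * (1 + i + 1) mod 3 = 1"
      "1 * (2 + i + 1) mod 3 = 2"
      "2 * (0 + i + 1) mod 3 = 0"
      "2 * (1 + i + 1) mod 3 = 2"
      "2 * (2 + i + 1) mod 3 = 1"
      using i by presburger+
    have e: "omega ^ (1 * (0 + i + 1)) = 1"
      "omega ^ (1 * (1 + i + 1)) = omega"
      "omega ^ (1 * (2 + i + 1)) = w"
      "omega ^ (2 * (0 + i + 1)) = 1"
      "omega ^ (2 * (1 + i + 1)) = w"
      "omega ^ (2 * (2 + i + 1)) = omega"
      by (simp_all only: pw m)
    have d: "3 dvd (0 + i + 1) \<longleftrightarrow> True" "3 dvd (1 + i + 1) \<longleftrightarrow> False" "3 dvd (2 + i + 1) \<longleftrightarrow> False"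
      using i by presburger+
    have "(1 - omega) * W 1 + (1 - w) * W 2 = 0 \<and> (1 - w) * W 1 + (1 - omega) * W 2 = 0 \<longleftrightarrow>
        W 1 = 0 \<and> W 2 = 0"
      using omega_system[of "W 1" "W 2"] by (auto simp: w_def)
    then show ?thesis
      unfolding ball2 all3 sum3 e d by (auto simp: add.commute)
  qed
qed

lemma is_diagonal_mop_iff:
  "is_diagonal_mop n p \<longleftrightarrow> lead_coeff p = 1 \<and> degree p = 2 * n \<and>
    (\<forall>i<n. \<forall>r<3. \<not> 3 dvd (r + i + 1) \<longrightarrow>
      poly (factorial_transform (poly_section r p)) ((of_nat (r + i) + 1) / 3) = 0)"
proof -
  have "cubic_moment k \<noteq> 0" for k using cubic_moment_pos[of k] by simp
  then have "(\<forall>j\<in>{1, 2}. ray_integral j (\<lambda>x. x ^ i * poly p x * exp (- (x ^ 3))) = 0) \<longleftrightarrow>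
    (\<forall>r<3. \<not> 3 dvd (r + i + 1) \<longrightarrow>
      poly (factorial_transform (poly_section r p)) ((of_nat (r + i) + 1) / 3) = 0)" for i
    unfolding ray_integral_sections omega_sums_vanish_iff by simp
  then show ?thesis unfolding is_diagonal_mop_def by blast
qed

section \<open>Uniqueness and explicit form of the diagonal polynomial\<close>

text \<open>The cardinality is the number of zeros prescribed for section \<open>r\<close>. A term
  of degree \<open>q\<close> in this section has exponent \<open>3 * q + r\<close>, so below degree
  \<open>2 * n\<close> the section has degree less than that number.\<close>

lemma card_not_dvd:
  "r < 3 \<Longrightarrow> 2 * n \<le> 3 * card {i. i < n \<and> \<not> 3 dvd (r + i + 1)} + r"
proof -
  assume r: "r < (3::nat)"
  have "card {i. i < n \<and> \<not> 3 dvd (r + i + 1)} = n - (n + r) div 3"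
  proof (induction n)
    case (Suc n)
    have *: "{i. i < Suc n \<and> \<not> 3 dvd (r + i + 1)} =
        (if 3 dvd (r + n + 1) then {i. i < n \<and> \<not> 3 dvd (r + i + 1)}
         else insert n {i. i < n \<and> \<not> 3 dvd (r + i + 1)})"
      by (auto simp: less_Suc_eq)
    show ?case
    proof (cases "3 dvd (r + n + 1)")
      case True
      then have "(Suc n + r) div 3 = Suc ((n + r) div 3)" by presburger
      with True Suc * show ?thesis by simp
    next
      case False
      then have "(Suc n + r) div 3 = (n + r) div 3" by presburger
      moreover have "(n + r) div 3 \<le> n" using r by linarith
      ultimately show ?thesis using False Suc * by (simp add: Suc_diff_le)
    qed
  qed (use r in simp)
  moreover have "(n + r) div 3 \<le> n" "3 * ((n + r) div 3) \<le> n + r" using r by linarith+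
  ultimately show ?thesis by linarith
qed

text \<open>The leading terms of two solutions cancel, so every section of the difference has a
  transform with more zeros than its degree allows.\<close>

lemma is_diagonal_mop_unique:
  assumes "is_diagonal_mop n p" "is_diagonal_mop n q"
  shows "p = q"
proof -
  define d where "d = p - q"
  have small: "coeff d m = 0" if "m \<ge> 2 * n" for m
    using assms that unfolding is_diagonal_mop_iff d_def
    by (cases "m = 2 * n") (auto simp: coeff_eq_0)
  have "poly_section r d = 0" if r: "r < 3" for r
  proof (rule ccontr)
    let ?I = "{i. i < n \<and> \<not> 3 dvd (r + i + 1)}"
    let ?t = "factorial_transform (poly_section r d)"
    assume nz: "poly_section r d \<noteq> 0"
    then have "coeff d (3 * degree (poly_section r d) + r) \<noteq> 0"
      using leading_coeff_neq_0[of "poly_section r d"] by simp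
    then have "3 * degree (poly_section r d) + r < 2 * n"
      using small by (meson not_le)
    then have "degree ?t < card ?I" using card_not_dvd[OF r, of n] by simp
    moreover have "inj_on (\<lambda>i. (of_nat (r + i) + 1) / 3 :: complex) ?I"
      by (rule inj_onI) simp
    then have "card ?I = card ((\<lambda>i. (of_nat (r + i) + 1) / 3 :: complex) ` ?I)"
      by (simp add: card_image)
    moreover have "card ((\<lambda>i. (of_nat (r + i) + 1) / 3 :: complex) ` ?I) \<le> card {z. poly ?t z = 0}"
    proof (rule card_mono)
      show "finite {z. poly ?t z = 0}" using nz by (intro poly_roots_finite) simp
      show "(\<lambda>i. (of_nat (r + i) + 1) / 3 :: complex) ` ?I \<subseteq> {z. poly ?t z = 0}"
        using assms r unfolding is_diagonal_mop_iff d_def poly_section_diff factorial_transform_diff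
        by auto
    qed
    moreover have "card {z. poly ?t z = 0} \<le> degree ?t"
      using nz by (intro card_poly_roots_bound) simp
    ultimately show False by linarith
  qed
  then have "d = 0" by (rule poly_eq_0_if_sections)
  then show ?thesis by (simp add: d_def)
qed

lemma coeff_pcompose_cube:
  "coeff (pcompose p (monom 1 3)) m = (if 3 dvd m then coeff p (m div 3) else (0 :: 'a::comm_semiring_1))"
proof (induction p arbitrary: m)
  case (pCons a p)
  show ?case
  proof (cases "m < 3")
    case True
    then have "m = 0 \<or> m \<noteq> 0 \<and> \<not> 3 dvd m" by presburger
    then show ?thesis
      using True by (elim disjE conjE) (simp_all add: pcompose_pCons coeff_monom_mult coeff_eq_0)
  next
    case False
    then obtain m' where m: "m = m' + 3" by (metis add.commute le_Suc_ex not_less)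
    have "3 dvd (m' + 3) \<longleftrightarrow> 3 dvd m'" "(m' + 3) div 3 = Suc (m' div 3)" by presburger+
    moreover have "coeff [:a:] (m' + 3) = 0" by (simp add: coeff_eq_0)
    ultimately show ?thesis
      unfolding m pcompose_pCons by (simp add: coeff_monom_mult pCons.IH)
  qed
qed simp

lemma poly_section_monom_mult_pcompose:
  assumes "r < 3" "r' < 3"
  shows "poly_section r' (monom 1 r * pcompose p (monom 1 3)) = (if r' = r then p else (0 :: complex poly))"
proof (rule poly_eqI)
  fix q
  have "r' = r \<or> 3 * q + r' < r \<and> r' \<noteq> r \<or> r \<le> 3 * q + r' \<and> r' \<noteq> r \<and> \<not> 3 dvd (3 * q + r' - r)"
    using assms by presburger
  then show "coeff (poly_section r' (monom 1 r * pcompose p (monom 1 3))) q = coeff (if r' = r then p else 0) q"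
    by (elim disjE conjE) (simp_all add: coeff_monom_mult coeff_pcompose_cube)
qed

text \<open>For \<open>r = 2 n mod 3\<close>, the numbers \<open>r + i + 1\<close> with \<open>i < n\<close> that are not divisible by 3 form two
  progressions of step 3, of lengths \<open>n div 3\<close> and \<open>(n + 1) div 3\<close>, with these first terms.\<close>
definition mop_shift_a :: "nat \<Rightarrow> nat" where "mop_shift_a n = (if n mod 3 = 0 then 1 else 4)"
definition mop_shift_b :: "nat \<Rightarrow> nat" where "mop_shift_b n = (if n mod 3 = 1 then 5 else 2)"

text \<open>A single section suffices: for \<open>r = 2 * n mod 3\<close> the prescribed zeros
  number \<open>n div 3 + (n + 1) div 3\<close>, which is exactly \<open>(2 * n - r) div 3\<close>.
  The other two sections are 0 and meet their conditions trivially. Uniqueness identifies this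
  candidate with \<open>diagonal_mop n\<close>.\<close>

lemma diagonal_mop_eq:
  obtains S :: "real multiset"
  where "\<And>s. s \<in># S \<Longrightarrow> s > 0"
    and "degree (diagonal_mop n) = 2 * n"
    and "diagonal_mop n = monom 1 (2 * n mod 3) * (\<Prod>s\<in>#S. [:- complex_of_real s, 0, 0, 1:])"
    and "factorial_transform (\<Prod>s\<in>#S. [:- complex_of_real s, 1:]) =
      (\<Prod>m<n div 3. [:- (of_nat (mop_shift_a n) / 3 + of_nat m), 1:]) *
      (\<Prod>m<(n + 1) div 3. [:- (of_nat (mop_shift_b n) / 3 + of_nat m), 1:])"
proof -
  define a b where "a = mop_shift_a n" and "b = mop_shift_b n"
  define k l where "k = n div 3" and "l = (n + 1) div 3"
  define r where "r = 2 * n mod 3"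
  define A where "A = (\<lambda>m. real a / 3 + real m) ` {..<k}"
  define B where "B = (\<lambda>m. real b / 3 + real m) ` {..<l}"
  \<comment> \<open>After multiplication by 3 the progressions lie in the residue classes 1 and 2
    modulo 3.\<close>
  have disj: "A \<inter> B = {}"
  proof -
    have "real a / 3 + real m \<noteq> real b / 3 + real m'" for m m'
    proof
      assume "real a / 3 + real m = real b / 3 + real m'"
      then have "real (a + 3 * m) = real (b + 3 * m')" by simp
      then have "a + 3 * m = b + 3 * m'" by (simp only: of_nat_eq_iff)
      then show False by (simp add: a_def b_def mop_shift_a_def mop_shift_b_def split: if_splits) presburger+
    qed
    then show ?thesis by (auto simp: A_def B_def)
  qed
  have inj: "inj_on (\<lambda>m. x + real m) M" for x M by (rule inj_onI) simp
  have card: "card (A \<union> B) = k + l"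
    using disj by (simp add: card_Un_disjoint A_def B_def card_image inj)
  obtain S where S: "\<And>s. s \<in># S \<Longrightarrow> s > 0" "size S = k + l"
    and T: "factorial_transform (\<Prod>s\<in>#S. [:- complex_of_real s, 1:]) = (\<Prod>c\<in>A \<union> B. [:- of_real c, 1:])"
  proof (rule factorial_transform_prod_linear_pos[of "A \<union> B"])
    show "c > 0" if "c \<in> A \<union> B" for c
      using that by (auto simp: A_def B_def a_def b_def mop_shift_a_def mop_shift_b_def add_pos_nonneg)
  qed (use card in \<open>auto simp: A_def B_def\<close>)
  have "(\<Prod>c\<in>A \<union> B. [:- complex_of_real c, 1:]) = (\<Prod>c\<in>A. [:- complex_of_real c, 1:]) * (\<Prod>c\<in>B. [:- complex_of_real c, 1:])"
    by (rule prod.union_disjoint) (use disj in \<open>auto simp: A_def B_def\<close>)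
  also have "(\<Prod>c\<in>A. [:- complex_of_real c, 1:]) = (\<Prod>m<k. [:- (of_nat a / 3 + of_nat m), 1:])"
    unfolding A_def by (subst prod.reindex) (simp_all add: inj)
  also have "(\<Prod>c\<in>B. [:- complex_of_real c, 1:]) = (\<Prod>m<l. [:- (of_nat b / 3 + of_nat m), 1:])"
    unfolding B_def by (subst prod.reindex) (simp_all add: inj)
  finally have T': "factorial_transform (\<Prod>s\<in>#S. [:- complex_of_real s, 1:]) =
      (\<Prod>m<k. [:- (of_nat a / 3 + of_nat m), 1:]) * (\<Prod>m<l. [:- (of_nat b / 3 + of_nat m), 1:])"
    by (simp only: T)
  define q where "q = (\<Prod>s\<in>#S. [:- complex_of_real s, 1:])"
  define p where "p = monom 1 r * pcompose q (monom 1 3)"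
  have q: "degree q = k + l" "lead_coeff q = 1"
  proof -
    have "degree (\<Prod>c\<in>A \<union> B. [:- complex_of_real c, 1:]) = card (A \<union> B)"
      by (subst degree_prod_sum_eq) auto
    then show "degree q = k + l"
      using arg_cong[OF T, of degree] by (simp add: q_def card)
    show "lead_coeff q = 1"
      using arg_cong[OF T, of lead_coeff]
      unfolding lead_coeff_factorial_transform lead_coeff_prod q_def by simp
  qed
  have mop: "is_diagonal_mop n p"
    unfolding is_diagonal_mop_iff
  proof (intro conjI allI impI)
    have "lead_coeff (pcompose q (monom 1 3)) = 1"
      using q by (subst lead_coeff_comp) (simp_all add: degree_monom_eq lead_coeff_monom)
    then show "lead_coeff p = 1" unfolding p_def lead_coeff_mult lead_coeff_monom by simp
    have "degree p = r + 3 * (k + l)"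
    proof -
      have "degree p = degree (monom (1::complex) r) + degree (pcompose q (monom 1 3))"
        unfolding p_def by (rule degree_mult_eq) (use \<open>lead_coeff (pcompose q (monom 1 3)) = 1\<close> in auto)
      then show ?thesis by (simp add: degree_monom_eq degree_pcompose q)
    qed
    also have "\<dots> = 2 * n" unfolding r_def k_def l_def by presburger
    finally show "degree p = 2 * n" .
    fix i r' assume i: "i < n" and r': "r' < 3" and nd: "\<not> 3 dvd (r' + i + 1)"
    show "poly (factorial_transform (poly_section r' p)) ((of_nat (r' + i) + 1) / 3) = 0"
    proof (cases "r' = r")
      case True
      have "(\<exists>m<k. r + i + 1 = a + 3 * m) \<or> (\<exists>m<l. r + i + 1 = b + 3 * m)"
      proof -
        consider "n mod 3 = 0" | "n mod 3 = 1" | "n mod 3 = 2" by linarith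
        then show ?thesis
        proof cases
          case 1
          then have "r = 0" "a = 1" "b = 2" by (simp_all add: r_def a_def b_def mop_shift_a_def mop_shift_b_def mod_mult_right_eq[of 2 n, symmetric])
          then show ?thesis using 1 nd i unfolding True k_def l_def by simp presburger
        next
          case 2
          then have "r = 2" "a = 4" "b = 5" by (simp_all add: r_def a_def b_def mop_shift_a_def mop_shift_b_def mod_mult_right_eq[of 2 n, symmetric])
          then show ?thesis using 2 nd i unfolding True k_def l_def by simp presburger
        next
          case 3
          then have "r = 1" "a = 4" "b = 2" by (simp_all add: r_def a_def b_def mop_shift_a_def mop_shift_b_def mod_mult_right_eq[of 2 n, symmetric])
          then show ?thesis using 3 nd i unfolding True k_def l_def by simp presburger
        qed
      qed
      then have "(of_nat (r + i) + 1) / 3 \<in> complex_of_real ` (A \<union> B)"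
      proof (elim disjE exE conjE)
        fix m assume m: "m < k" "r + i + 1 = a + 3 * m"
        have "(of_nat (r + i) + 1) / 3 = complex_of_real (real (r + i + 1) / 3)" by simp
        also have "real (r + i + 1) / 3 = real a / 3 + real m" unfolding m by simp
        finally have eq: "(of_nat (r + i) + 1) / 3 = complex_of_real (real a / 3 + real m)" .
        show ?thesis unfolding eq by (rule imageI) (use m(1) in \<open>auto simp: A_def\<close>)
      next
        fix m assume m: "m < l" "r + i + 1 = b + 3 * m"
        have "(of_nat (r + i) + 1) / 3 = complex_of_real (real (r + i + 1) / 3)" by simp
        also have "real (r + i + 1) / 3 = real b / 3 + real m" unfolding m by simp
        finally have eq: "(of_nat (r + i) + 1) / 3 = complex_of_real (real b / 3 + real m)" .
        show ?thesis unfolding eq by (rule imageI) (use m(1) in \<open>auto simp: B_def\<close>)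
      qed
      then obtain c where "c \<in> A \<union> B" "(of_nat (r + i) + 1) / 3 = complex_of_real c" by blast
      moreover have "finite (A \<union> B)" by (simp add: A_def B_def)
      ultimately show ?thesis
        using r' unfolding True p_def poly_section_monom_mult_pcompose[OF r'[unfolded True] r'[unfolded True]]
        by (auto simp: T[folded q_def] poly_prod intro!: prod_zero)
    next
      case False
      have "r < 3" by (simp add: r_def)
      then show ?thesis using False r' by (simp add: p_def poly_section_monom_mult_pcompose)
    qed
  qed
  then have "diagonal_mop n = p"
    unfolding diagonal_mop_def using is_diagonal_mop_unique by blast
  moreover from this have "degree (diagonal_mop n) = 2 * n"
    using mop by (simp add: is_diagonal_mop_def)
  moreover have "pcompose q (monom 1 3) = (\<Prod>s\<in>#S. [:- complex_of_real s, 0, 0, 1:])"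
  proof -
    have "pcompose [:- c, 1:] (monom 1 3) = [:- c, 0, 0, 1 :: complex:]" for c
      by (simp add: pcompose_pCons eval_nat_numeral monom_Suc monom_0)
    then show ?thesis
      unfolding q_def by (induction S) (simp_all add: pcompose_mult pcompose_1 del: mult_pCons_left)
  qed
  ultimately show ?thesis
    using S T' by (intro that[of S]) (simp_all add: p_def r_def k_def l_def a_def b_def)
qed

section \<open>Weak convergence\<close>

text \<open>Sums over zeros and the limit integral are treated alike as functionals. Monotonicity
  compares functions only on the half-line of nonnegative reals, which encodes that the mass sits
  there.\<close>

definition positive_linear :: "((real \<Rightarrow> real) \<Rightarrow> real) \<Rightarrow> bool" where
  "positive_linear E \<longleftrightarrow>
    (\<forall>f g. continuous_on UNIV f \<longrightarrow> continuous_on UNIV g \<longrightarrow> E (\<lambda>x. f x + g x) = E f + E g) \<and>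
    (\<forall>f c. continuous_on UNIV f \<longrightarrow> E (\<lambda>x. c * f x) = c * E f) \<and>
    (\<forall>f g. continuous_on UNIV f \<longrightarrow> continuous_on UNIV g \<longrightarrow> (\<forall>x\<ge>0. f x \<le> g x) \<longrightarrow> E f \<le> E g)"

lemma
  assumes "positive_linear E"
  shows positive_linear_add: "continuous_on UNIV f \<Longrightarrow> continuous_on UNIV g \<Longrightarrow> E (\<lambda>x. f x + g x) = E f + E g"
    and positive_linear_cmult: "continuous_on UNIV f \<Longrightarrow> E (\<lambda>x. c * f x) = c * E f"
    and positive_linear_mono: "continuous_on UNIV f \<Longrightarrow> continuous_on UNIV g \<Longrightarrow>
      (\<And>x. x \<ge> 0 \<Longrightarrow> f x \<le> g x) \<Longrightarrow> E f \<le> E g"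
  using assms unfolding positive_linear_def by blast+

lemma positive_linear_sum:
  assumes E: "positive_linear E" and f: "\<And>i. i \<in> I \<Longrightarrow> continuous_on UNIV (f i)" and "finite I"
  shows "E (\<lambda>x. \<Sum>i\<in>I. c i * f i x) = (\<Sum>i\<in>I. c i * E (f i))"
  using \<open>finite I\<close> f
proof (induction I rule: finite_induct)
  case empty
  show ?case using positive_linear_cmult[OF E continuous_on_const, of 0 0] by simp
next
  case (insert i I)
  have "E (\<lambda>x. \<Sum>i\<in>insert i I. c i * f i x) = E (\<lambda>x. c i * f i x + (\<Sum>i\<in>I. c i * f i x))"
    using insert.hyps by simp
  also have "\<dots> = E (\<lambda>x. c i * f i x) + E (\<lambda>x. \<Sum>i\<in>I. c i * f i x)"
    by (intro positive_linear_add[OF E] continuous_intros insert.prems) auto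
  also have "\<dots> = c i * E (f i) + (\<Sum>i\<in>I. c i * E (f i))"
    using insert by (simp add: positive_linear_cmult[OF E])
  finally show ?case using insert.hyps by simp
qed

lemma positive_linear_abs_diff_le:
  assumes E: "positive_linear E" and f: "continuous_on UNIV f" and g: "continuous_on UNIV g"
    and h: "continuous_on UNIV h" and le: "\<And>x. x \<ge> 0 \<Longrightarrow> \<bar>f x - g x\<bar> \<le> h x"
  shows "\<bar>E f - E g\<bar> \<le> E h"
proof -
  have "E f \<le> E (\<lambda>x. g x + h x)" "E g \<le> E (\<lambda>x. f x + h x)"
    by (intro positive_linear_mono[OF E] f g h continuous_intros; use le in \<open>force simp: abs_le_iff\<close>)+
  moreover have "E (\<lambda>x. g x + h x) = E g + E h" "E (\<lambda>x. f x + h x) = E f + E h"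
    using f g h by (simp_all add: positive_linear_add[OF E])
  ultimately show ?thesis by linarith
qed

text \<open>The growth bound on the moments makes the part of \<open>f - p\<close> outside \<open>[0, R]\<close> negligible, where
  \<open>p\<close> is a polynomial close to \<open>f\<close> on \<open>[0, R]\<close>: it is dominated by \<open>x\<^sup>N (x / R)\<^sup>k\<close> for every \<open>k\<close>.\<close>
lemma positive_linear_tendsto_if_moments:
  fixes E :: "nat \<Rightarrow> (real \<Rightarrow> real) \<Rightarrow> real"
  assumes E: "\<And>n. positive_linear (E n)" and E0: "positive_linear E0"
    and moments: "\<And>k. (\<lambda>n. E n (\<lambda>x. x ^ k)) \<longlonglongrightarrow> E0 (\<lambda>x. x ^ k)"
    and bound: "\<And>k. E0 (\<lambda>x. x ^ k) \<le> C * \<rho> ^ k" and \<rho>: "\<rho> \<ge> 0"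
    and f: "continuous_on UNIV f" and fB: "\<And>x. \<bar>f x\<bar> \<le> B"
  shows "(\<lambda>n. E n f) \<longlonglongrightarrow> E0 f"
proof (rule LIMSEQ_I)
  fix \<epsilon>' :: real assume "\<epsilon>' > 0"
  \<comment> \<open>Any radius above \<rho> makes the tail decay geometrically; the added 1 also
    gives \<open>R \<ge> 1\<close>, so beyond \<open>R\<close> lower powers are dominated by higher
    ones.\<close>
  define R where "R = \<rho> + 1"
  have R: "R \<ge> 1" "\<rho> / R < 1" using \<rho> by (simp_all add: R_def)
  define M0 where "M0 = E0 (\<lambda>x. x ^ 0)"
  have M0: "M0 \<ge> 0"
    using positive_linear_mono[OF E0, of "\<lambda>x. 0" "\<lambda>x. x ^ 0"] positive_linear_cmult[OF E0, of "\<lambda>x. 0" 0]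
    by (simp add: M0_def)
  \<comment> \<open>The total error will be below \<open>2 * M0 + 3\<close> times \<epsilon>:
    \<open>M0 + 1\<close> from the approximation under each of the two functionals, and 1 from the
    polynomial moments.\<close>
  define \<epsilon> where "\<epsilon> = \<epsilon>' / (2 * M0 + 6)"
  have \<epsilon>: "\<epsilon> > 0" using \<open>\<epsilon>' > 0\<close> M0 by (simp add: \<epsilon>_def)
  have "continuous_on {0..R} f" using f by (rule continuous_on_subset) simp
  then obtain p where "real_polynomial_function p" and p: "\<And>x. x \<in> {0..R} \<Longrightarrow> \<bar>f x - p x\<bar> < \<epsilon>"
    using Stone_Weierstrass_real_polynomial_function[OF compact_Icc _ \<epsilon>, of 0 R f] by metis
  then obtain a N where pa: "p = (\<lambda>x. \<Sum>i\<le>N. a i * x ^ i)"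
    unfolding real_polynomial_function_iff_sum by blast
  have p_cont: "continuous_on UNIV p" unfolding pa by (intro continuous_intros)
  define A where "A = B + (\<Sum>i\<le>N. \<bar>a i\<bar>)"
  have B0: "B \<ge> 0" using fB[of 0] by linarith
  then have A: "A \<ge> 0" by (simp add: A_def sum_nonneg)
  have dom: "\<bar>f x - p x\<bar> \<le> \<epsilon> * x ^ 0 + A / R ^ k * x ^ (N + k)" if x: "x \<ge> 0" for x k
  proof (cases "x \<le> R")
    case True
    then have "\<bar>f x - p x\<bar> < \<epsilon>" using x p by simp
    moreover have "A / R ^ k * x ^ (N + k) \<ge> 0" using x A R by simp
    ultimately show ?thesis by simp
  next
    case False
    then have x1: "x \<ge> 1" using R by simp
    have "\<bar>p x\<bar> \<le> (\<Sum>i\<le>N. \<bar>a i\<bar> * x ^ N)"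
      unfolding pa
      by (rule order_trans[OF sum_abs], rule sum_mono)
         (use x1 in \<open>auto simp: abs_mult intro!: mult_left_mono power_increasing\<close>)
    moreover have "\<bar>f x\<bar> \<le> B * x ^ N"
      using mult_left_mono[of 1 "x ^ N" B] fB[of x] x1 B0 by simp
    ultimately have "\<bar>f x - p x\<bar> \<le> A * x ^ N"
      using abs_triangle_ineq4[of "f x" "p x"]
      by (simp add: A_def distrib_right flip: sum_distrib_right)
    also have "\<dots> \<le> A * x ^ N * (x / R) ^ k"
      using False R A x1 mult_left_mono[of 1 "(x / R) ^ k" "A * x ^ N"] by simp
    also have "\<dots> = A / R ^ k * x ^ (N + k)"
      by (simp add: power_divide power_add)
    finally show ?thesis using \<epsilon> by simp
  qed
  define h where "h = (\<lambda>k x. \<epsilon> * x ^ 0 + A / R ^ k * x ^ (N + k) :: real)"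
  have Eh: "E' (h k) = \<epsilon> * E' (\<lambda>x. x ^ 0) + A / R ^ k * E' (\<lambda>x. x ^ (N + k))" if "positive_linear E'" for E' k
  proof -
    have "E' (h k) = E' (\<lambda>x. \<epsilon> * x ^ 0) + E' (\<lambda>x. A / R ^ k * x ^ (N + k))"
      unfolding h_def by (rule positive_linear_add[OF that]) (intro continuous_intros)+
    moreover have "continuous_on UNIV (\<lambda>x :: real. x ^ m)" for m by (intro continuous_intros)
    ultimately show ?thesis by (simp only: positive_linear_cmult[OF that])
  qed
  have diff: "\<bar>E' f - E' p\<bar> \<le> E' (h k)" if "positive_linear E'" for E' k
  proof (rule positive_linear_abs_diff_le[OF that f p_cont])
    show "continuous_on UNIV (h k)" unfolding h_def using R by (intro continuous_intros) auto
    show "\<bar>f x - p x\<bar> \<le> h k x" if "x \<ge> 0" for x unfolding h_def using that by (rule dom)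
  qed
  \<comment> \<open>The exponent \<open>k\<close> is fixed using the limit functional alone. Since
    \<open>h k\<close> is a polynomial, moment convergence then transfers the bound to
    \<open>E n\<close> for large \<open>n\<close>.\<close>
  have "(\<lambda>k. A * \<bar>C\<bar> * \<rho> ^ N * (\<rho> / R) ^ k) \<longlonglongrightarrow> A * \<bar>C\<bar> * \<rho> ^ N * 0"
    using \<rho> R by (intro tendsto_intros LIMSEQ_power_zero) simp
  then have "\<forall>\<^sub>F k in sequentially. A * \<bar>C\<bar> * \<rho> ^ N * (\<rho> / R) ^ k < \<epsilon>"
    using \<epsilon> by (intro order_tendstoD(2)) simp_all
  then obtain k where k: "A * \<bar>C\<bar> * \<rho> ^ N * (\<rho> / R) ^ k < \<epsilon>"
    by (auto simp: eventually_sequentially)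
  have "A / R ^ k * E0 (\<lambda>x. x ^ (N + k)) \<le> A / R ^ k * (\<bar>C\<bar> * \<rho> ^ (N + k))"
    using A R order_trans[OF bound[of "N + k"] mult_right_mono[OF abs_ge_self]] \<rho>
    by (intro mult_left_mono) auto
  also have "\<dots> = A * \<bar>C\<bar> * \<rho> ^ N * (\<rho> / R) ^ k" by (simp add: power_add power_divide)
  finally have E0h: "E0 (h k) < \<epsilon> * M0 + \<epsilon>" using k by (simp add: Eh[OF E0] M0_def)
  have "(\<lambda>n. E n (h k)) \<longlonglongrightarrow> E0 (h k)"
    unfolding Eh[OF E] Eh[OF E0] by (intro tendsto_intros moments)
  then have ev1: "\<forall>\<^sub>F n in sequentially. E n (h k) < \<epsilon> * M0 + \<epsilon>"
    using E0h by (rule order_tendstoD(2))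
  have Ep: "E' p = (\<Sum>i\<le>N. a i * E' (\<lambda>x. x ^ i))" if "positive_linear E'" for E'
    unfolding pa by (rule positive_linear_sum[OF that]) (auto intro!: continuous_intros)
  have "(\<lambda>n. E n p) \<longlonglongrightarrow> E0 p"
    unfolding Ep[OF E] Ep[OF E0] by (intro tendsto_intros moments)
  then have ev2: "\<forall>\<^sub>F n in sequentially. \<bar>E n p - E0 p\<bar> < \<epsilon>"
    using \<epsilon> by (simp add: tendsto_iff dist_real_def)
  have "\<forall>\<^sub>F n in sequentially. norm (E n f - E0 f) < \<epsilon>'"
    using ev1 ev2
  proof eventually_elim
    case (elim n)
    have "\<bar>E n f - E0 f\<bar> < (\<epsilon> * M0 + \<epsilon>) + \<epsilon> + (\<epsilon> * M0 + \<epsilon>)"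
      using diff[OF E, of n k] diff[OF E0, of k] elim E0h by linarith
    also have "\<dots> < \<epsilon> * (2 * M0 + 6)" using \<epsilon> by (simp add: algebra_simps)
    also have "\<dots> = \<epsilon>'" using M0 by (simp add: \<epsilon>_def)
    finally show ?case by simp
  qed
  then show "\<exists>n0. \<forall>n\<ge>n0. norm (E n f - E0 f) < \<epsilon>'"
    by (simp add: eventually_sequentially)
qed

lemma positive_linear_v_fun_integral:
  "positive_linear (\<lambda>f. integral {0..v_end} (\<lambda>x. v_fun x * f (x ^ 3)))"
proof -
  have int: "(\<lambda>x. v_fun x * f (x ^ 3)) integrable_on {0..v_end}" if "continuous_on UNIV f" for f
    by (intro integrable_continuous_real continuous_intros continuous_on_compose2[OF that]) auto
  show ?thesis
    unfolding positive_linear_def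
  proof (intro conjI allI impI)
    fix f g :: "real \<Rightarrow> real" assume fg: "continuous_on UNIV f" "continuous_on UNIV g"
    show "integral {0..v_end} (\<lambda>x. v_fun x * (f (x ^ 3) + g (x ^ 3))) =
        integral {0..v_end} (\<lambda>x. v_fun x * f (x ^ 3)) + integral {0..v_end} (\<lambda>x. v_fun x * g (x ^ 3))"
      unfolding distrib_left by (intro integral_add int fg)
    assume le: "\<forall>x\<ge>0. f x \<le> g x"
    show "integral {0..v_end} (\<lambda>x. v_fun x * f (x ^ 3)) \<le> integral {0..v_end} (\<lambda>x. v_fun x * g (x ^ 3))"
      by (intro integral_le int fg mult_left_mono) (use le v_fun_nonneg in auto)
  next
    fix f :: "real \<Rightarrow> real" and c :: real
    show "integral {0..v_end} (\<lambda>x. v_fun x * (c * f (x ^ 3))) = c * integral {0..v_end} (\<lambda>x. v_fun x * f (x ^ 3))"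
      by (simp add: mult.left_commute)
  qed
qed

lemma v_fun_moment:
  "integral {0..v_end} (\<lambda>x. v_fun x * (x ^ 3) ^ k) = real (3 * k choose k) / (3 ^ Suc k * real (Suc k))"
  using v_fun_moment_has_integral[of k] by (simp add: integral_unique flip: power_mult)

lemma v_fun_moment_le: "integral {0..v_end} (\<lambda>x. v_fun x * (x ^ 3) ^ k) \<le> 1 / 3 * (9 / 4) ^ k"
proof -
  have "integral {0..v_end} (\<lambda>x. v_fun x * (x ^ 3) ^ k) \<le> integral {0..v_end} (\<lambda>x. v_fun x * (9 / 4) ^ k)"
  proof (intro integral_le integrable_continuous_real continuous_intros mult_left_mono power_mono)
    fix x assume "x \<in> {0..v_end}"
    then show "x ^ 3 \<le> 9 / 4" "0 \<le> x ^ 3" "0 \<le> v_fun x"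
      using cube_le_of_le_v_end[of x] v_fun_nonneg[of x] by auto
  qed
  also have "\<dots> = integral {0..v_end} v_fun * (9 / 4) ^ k" by simp
  also have "integral {0..v_end} v_fun = 1 / 3" using v_fun_moment[of 0] by simp
  finally show ?thesis .
qed

section \<open>Asymptotics of the cubed zeros\<close>

lemma bounded_deviation_div_tendsto:
  fixes u :: "nat \<Rightarrow> real"
  assumes "\<And>n. \<bar>u n - c * real n\<bar> \<le> K"
  shows "(\<lambda>n. u n / real n) \<longlonglongrightarrow> c"
proof -
  have "(\<lambda>n. K / real n) \<longlonglongrightarrow> 0" by (rule lim_const_over_n)
  moreover have "\<forall>\<^sub>F n in sequentially. norm (u n / real n - c) \<le> K / real n"
    using eventually_gt_at_top[of 0]
  proof eventually_elim
    case (elim n)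
    have "u n / real n - c = (u n - c * real n) / real n" using elim by (simp add: diff_divide_distrib)
    then show ?case using assms[of n] elim by (simp add: divide_right_mono)
  qed
  ultimately have "(\<lambda>n. u n / real n - c) \<longlonglongrightarrow> 0" by (rule Lim_null_comparison[rotated])
  then show ?thesis by (simp add: LIM_zero_iff)
qed

text \<open>The existence statement holds for each \<open>n\<close> separately; the choice turns it
  into a sequence of multisets. The nonzero zeros of \<open>diagonal_mop n\<close> are the complex
  cube roots of these numbers.\<close>

definition cubed_zeros :: "nat \<Rightarrow> real multiset" where
  "cubed_zeros n = (SOME S. (\<forall>s\<in>#S. s > 0) \<and>
    diagonal_mop n = monom 1 (2 * n mod 3) * (\<Prod>s\<in>#S. [:- complex_of_real s, 0, 0, 1:]) \<and>
    factorial_transform (\<Prod>s\<in>#S. [:- complex_of_real s, 1:]) =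
      (\<Prod>m<n div 3. [:- (of_nat (mop_shift_a n) / 3 + of_nat m), 1:]) *
      (\<Prod>m<(n + 1) div 3. [:- (of_nat (mop_shift_b n) / 3 + of_nat m), 1:]))"

lemma
  shows cubed_zeros_pos: "s \<in># cubed_zeros n \<Longrightarrow> s > 0"
    and diagonal_mop_cubed_zeros:
      "diagonal_mop n = monom 1 (2 * n mod 3) * (\<Prod>s\<in>#cubed_zeros n. [:- complex_of_real s, 0, 0, 1:])"
    and factorial_transform_cubed_zeros:
      "factorial_transform (\<Prod>s\<in>#cubed_zeros n. [:- complex_of_real s, 1:]) =
        (\<Prod>m<n div 3. [:- (of_nat (mop_shift_a n) / 3 + of_nat m), 1:]) *
        (\<Prod>m<(n + 1) div 3. [:- (of_nat (mop_shift_b n) / 3 + of_nat m), 1:])"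
proof -
  have "\<exists>S. (\<forall>s\<in>#S. s > 0) \<and>
    diagonal_mop n = monom 1 (2 * n mod 3) * (\<Prod>s\<in>#S. [:- complex_of_real s, 0, 0, 1:]) \<and>
    factorial_transform (\<Prod>s\<in>#S. [:- complex_of_real s, 1:]) =
      (\<Prod>m<n div 3. [:- (of_nat (mop_shift_a n) / 3 + of_nat m), 1:]) *
      (\<Prod>m<(n + 1) div 3. [:- (of_nat (mop_shift_b n) / 3 + of_nat m), 1:])"
    by (rule diagonal_mop_eq[of n]) blast
  from someI_ex[OF this, folded cubed_zeros_def] show
    "s \<in># cubed_zeros n \<Longrightarrow> s > 0"
    "diagonal_mop n = monom 1 (2 * n mod 3) * (\<Prod>s\<in>#cubed_zeros n. [:- complex_of_real s, 0, 0, 1:])"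
    "factorial_transform (\<Prod>s\<in>#cubed_zeros n. [:- complex_of_real s, 1:]) =
        (\<Prod>m<n div 3. [:- (of_nat (mop_shift_a n) / 3 + of_nat m), 1:]) *
        (\<Prod>m<(n + 1) div 3. [:- (of_nat (mop_shift_b n) / 3 + of_nat m), 1:])"
    by blast+
qed

text \<open>The starting points of the progressions are bounded and their lengths differ from
  \<open>n / 3\<close> by a bounded amount, as \<open>power_sums_tendsto\<close> demands. The
  transform identity lives over the complex numbers, so the limit is taken there and then pulled
  back to the reals.\<close>

lemma cubed_zeros_moments:
  "(\<lambda>n. (\<Sum>s\<in>#cubed_zeros n. (s / real n) ^ j) / real n) \<longlonglongrightarrow>
    2 * real (3 * j choose j) / (3 ^ Suc j * real (Suc j))"
proof -
  obtain L :: "complex fps" where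
    L: "L = fps_const (2 / 3) + fps_X * (2 * L\<^sup>2 - fps_const (2 / 3) * L - fps_const (1 / 9))
              - fps_X * (fps_X * L ^ 3)" and
    L_nth: "\<And>k. fps_nth L k = 2 * of_nat ((3 * k) choose k) / (3 ^ Suc k * of_nat (Suc k))"
    by (rule limit_fps[where 'a = complex], rule that)
  have div3: "\<bar>real (n div 3) - 1 / 3 * real n\<bar> \<le> 2" "\<bar>real ((n + 1) div 3) - 1 / 3 * real n\<bar> \<le> 2" for n
  proof -
    have "real (3 * (n div 3)) \<le> real n" "real n \<le> real (3 * (n div 3) + 2)"
      "real (3 * ((n + 1) div 3)) \<le> real (n + 1)" "real (n + 1) \<le> real (3 * ((n + 1) div 3) + 2)"
      unfolding of_nat_le_iff by linarith+
    then show "\<bar>real (n div 3) - 1 / 3 * real n\<bar> \<le> 2" "\<bar>real ((n + 1) div 3) - 1 / 3 * real n\<bar> \<le> 2"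
      by simp_all
  qed
  have "(\<lambda>n. real (mop_shift_a n) / 3 / real n) \<longlonglongrightarrow> 0" "(\<lambda>n. real (mop_shift_b n) / 3 / real n) \<longlonglongrightarrow> 0"
    by (rule bounded_deviation_div_tendsto[where K = 2]; simp add: mop_shift_a_def mop_shift_b_def)+
  moreover have "(\<lambda>n. real (n div 3) / real n) \<longlonglongrightarrow> 1 / 3" "(\<lambda>n. real ((n + 1) div 3) / real n) \<longlonglongrightarrow> 1 / 3"
    by (rule bounded_deviation_div_tendsto[where K = 2], rule div3)+
  ultimately have "(\<lambda>n. real (mop_shift_a n) / 3 / real n) \<longlonglongrightarrow> 0" "(\<lambda>n. real (mop_shift_b n) / 3 / real n) \<longlonglongrightarrow> 0"
    "(\<lambda>n. real (n div 3) / real n) \<longlonglongrightarrow> 1 / 3" "(\<lambda>n. real ((n + 1) div 3) / real n) \<longlonglongrightarrow> 1 / 3"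
    by blast+
  note this[THEN tendsto_of_real, where 'a = complex]
  then have lims: "(\<lambda>n. of_nat (mop_shift_a n) / 3 / of_nat n :: complex) \<longlonglongrightarrow> 0"
    "(\<lambda>n. of_nat (mop_shift_b n) / 3 / of_nat n :: complex) \<longlonglongrightarrow> 0"
    "(\<lambda>n. of_nat (n div 3) / of_nat n :: complex) \<longlonglongrightarrow> 1 / 3"
    "(\<lambda>n. of_nat ((n + 1) div 3) / of_nat n :: complex) \<longlonglongrightarrow> 1 / 3"
    by simp_all
  have T: "factorial_transform (\<Prod>s\<in>#image_mset complex_of_real (cubed_zeros n). [:- s, 1:]) =
      (\<Prod>m<n div 3. [:- (of_nat (mop_shift_a n) / 3 + of_nat m), 1:]) *
      (\<Prod>m<(n + 1) div 3. [:- (of_nat (mop_shift_b n) / 3 + of_nat m), 1:])" for n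
    using factorial_transform_cubed_zeros[of n] by (simp add: image_mset.compositionality o_def)
  have "(\<lambda>n. (\<Sum>s\<in>#image_mset complex_of_real (cubed_zeros n). (s / of_nat n) ^ j) / of_nat n) \<longlonglongrightarrow> fps_nth L j"
    by (rule power_sums_tendsto[OF T lims L])
  also have "(\<lambda>n. (\<Sum>s\<in>#image_mset complex_of_real (cubed_zeros n). (s / of_nat n) ^ j) / of_nat n) =
      (\<lambda>n. complex_of_real ((\<Sum>s\<in>#cubed_zeros n. (s / real n) ^ j) / real n))"
  proof
    fix n
    have "(\<Sum>s\<in>#image_mset complex_of_real S. (s / of_nat n) ^ j) =
        complex_of_real (\<Sum>s\<in>#S. (s / real n) ^ j)" for S by (induction S) simp_all
    then show "(\<Sum>s\<in>#image_mset complex_of_real (cubed_zeros n). (s / of_nat n) ^ j) / of_nat n =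
        complex_of_real ((\<Sum>s\<in>#cubed_zeros n. (s / real n) ^ j) / real n)" by simp
  qed
  also have "fps_nth L j = complex_of_real (2 * real (3 * j choose j) / (3 ^ Suc j * real (Suc j)))"
    unfolding L_nth by simp
  finally show ?thesis unfolding tendsto_of_real_iff .
qed

lemma cubed_zeros_tendsto_real:
  fixes f :: "real \<Rightarrow> real"
  assumes f: "continuous_on UNIV f" and B: "\<And>x. \<bar>f x\<bar> \<le> B"
  shows "(\<lambda>n. (\<Sum>s\<in>#cubed_zeros n. f (s / real n)) / (2 * real n)) \<longlonglongrightarrow>
    integral {0..v_end} (\<lambda>x. v_fun x * f (x ^ 3))"
proof (rule positive_linear_tendsto_if_moments[where C = "1 / 3" and \<rho> = "9 / 4" and f = f and B = B
      and E = "\<lambda>n f. (\<Sum>s\<in>#cubed_zeros n. f (s / real n)) / (2 * real n)"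
      and ?E0.0 = "\<lambda>f. integral {0..v_end} (\<lambda>x. v_fun x * f (x ^ 3))"])
  show "positive_linear (\<lambda>f. (\<Sum>s\<in>#cubed_zeros n. f (s / real n)) / (2 * real n))" for n
    unfolding positive_linear_def
  proof (intro conjI allI impI)
    fix f g :: "real \<Rightarrow> real"
    show "(\<Sum>s\<in>#cubed_zeros n. f (s / real n) + g (s / real n)) / (2 * real n) =
      (\<Sum>s\<in>#cubed_zeros n. f (s / real n)) / (2 * real n) + (\<Sum>s\<in>#cubed_zeros n. g (s / real n)) / (2 * real n)"
      by (simp add: sum_mset.distrib add_divide_distrib)
    assume "\<forall>x\<ge>0. f x \<le> g x"
    then have "(\<Sum>s\<in>#cubed_zeros n. f (s / real n)) \<le> (\<Sum>s\<in>#cubed_zeros n. g (s / real n))"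
      by (intro sum_mset_mono) (simp add: cubed_zeros_pos less_imp_le)
    then show "(\<Sum>s\<in>#cubed_zeros n. f (s / real n)) / (2 * real n) \<le> (\<Sum>s\<in>#cubed_zeros n. g (s / real n)) / (2 * real n)"
      by (intro divide_right_mono) auto
  next
    fix f :: "real \<Rightarrow> real" and c :: real
    show "(\<Sum>s\<in>#cubed_zeros n. c * f (s / real n)) / (2 * real n) = c * ((\<Sum>s\<in>#cubed_zeros n. f (s / real n)) / (2 * real n))"
      by (simp add: sum_mset_distrib_left)
  qed
  \<comment> \<open>Normalising by \<open>2 * n\<close>, the number of all zeros of
    \<open>diagonal_mop n\<close>, cancels the factor 2 in the limit moments and leaves the moments
    of \<open>v_fun\<close>.\<close>
  show "(\<lambda>n. (\<Sum>s\<in>#cubed_zeros n. (s / real n) ^ k) / (2 * real n)) \<longlonglongrightarrow> integral {0..v_end} (\<lambda>x. v_fun x * (x ^ 3) ^ k)" for k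
    unfolding v_fun_moment using tendsto_divide[OF cubed_zeros_moments[of k] tendsto_const[of 2]]
    by (simp add: mult_ac)
qed (use f B positive_linear_v_fun_integral v_fun_moment_le in auto)

lemma cubed_zeros_tendsto:
  fixes f :: "real \<Rightarrow> complex"
  assumes f: "continuous_on UNIV f" and B: "bounded (range f)"
  shows "(\<lambda>n. (\<Sum>s\<in>#cubed_zeros n. f (s / real n)) / (2 * of_nat n)) \<longlonglongrightarrow>
    (LBINT x:{0..v_end}. of_real (v_fun x) * f (x ^ 3))"
proof -
  obtain K where K: "\<And>x. cmod (f x) \<le> K" using B by (auto simp: bounded_iff)
  have cont: "continuous_on {0..v_end} (\<lambda>x. of_real (v_fun x) * f (x ^ 3))"
    by (intro continuous_intros continuous_on_compose2[OF f]) auto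
  then have eq: "(LBINT x:{0..v_end}. of_real (v_fun x) * f (x ^ 3)) = integral {0..v_end} (\<lambda>x. of_real (v_fun x) * f (x ^ 3))"
    by (intro set_borel_integral_eq_integral borel_integrable_atLeastAtMost')
  have int: "(\<lambda>x. of_real (v_fun x) * f (x ^ 3)) integrable_on {0..v_end}"
    using cont by (rule integrable_continuous_real)
  have "(\<lambda>n. (\<Sum>s\<in>#cubed_zeros n. Re (f (s / real n))) / (2 * real n)) \<longlonglongrightarrow> integral {0..v_end} (\<lambda>x. v_fun x * Re (f (x ^ 3)))"
    "(\<lambda>n. (\<Sum>s\<in>#cubed_zeros n. Im (f (s / real n))) / (2 * real n)) \<longlonglongrightarrow> integral {0..v_end} (\<lambda>x. v_fun x * Im (f (x ^ 3)))"
    by (rule cubed_zeros_tendsto_real[where B = K];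
        use f K abs_Re_le_cmod abs_Im_le_cmod in \<open>auto intro!: continuous_intros intro: order_trans\<close>)+
  moreover have "Re ((\<Sum>s\<in>#cubed_zeros n. f (s / real n)) / (2 * of_nat n)) = (\<Sum>s\<in>#cubed_zeros n. Re (f (s / real n))) / (2 * real n)"
    "Im ((\<Sum>s\<in>#cubed_zeros n. f (s / real n)) / (2 * of_nat n)) = (\<Sum>s\<in>#cubed_zeros n. Im (f (s / real n))) / (2 * real n)" for n
  proof -
    have "Re (\<Sum>s\<in>#S. f (s / real n)) = (\<Sum>s\<in>#S. Re (f (s / real n)))"
      "Im (\<Sum>s\<in>#S. f (s / real n)) = (\<Sum>s\<in>#S. Im (f (s / real n)))" for S
      by (induction S) simp_all
    moreover have "2 * of_nat n = complex_of_real (2 * real n)" by simp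
    ultimately show "Re ((\<Sum>s\<in>#cubed_zeros n. f (s / real n)) / (2 * of_nat n)) = (\<Sum>s\<in>#cubed_zeros n. Re (f (s / real n))) / (2 * real n)"
      "Im ((\<Sum>s\<in>#cubed_zeros n. f (s / real n)) / (2 * of_nat n)) = (\<Sum>s\<in>#cubed_zeros n. Im (f (s / real n))) / (2 * real n)"
      by (simp_all only: Re_divide_of_real Im_divide_of_real)
  qed
  moreover have "integral {0..v_end} (\<lambda>x. v_fun x * Re (f (x ^ 3))) = Re (integral {0..v_end} (\<lambda>x. of_real (v_fun x) * f (x ^ 3)))"
    "integral {0..v_end} (\<lambda>x. v_fun x * Im (f (x ^ 3))) = Im (integral {0..v_end} (\<lambda>x. of_real (v_fun x) * f (x ^ 3)))"
    using integral_linear[OF int bounded_linear_Re] integral_linear[OF int bounded_linear_Im]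
    by (simp_all add: o_def)
  ultimately show ?thesis unfolding eq tendsto_complex_iff by (simp only: simp_thms)
qed

section \<open>From cubed zeros to the zero-counting measure\<close>

lemma poly_cube_factor:
  "[:- complex_of_real (x ^ 3), 0, 0, 1:] =
    [:- of_real x, 1:] * [:- (omega * of_real x), 1:] * [:- (omega\<^sup>2 * of_real x), 1:]"
proof -
  have prod3: "[:- p, 1:] * [:- q, 1:] * [:- r, 1:] = [:- (p * q * r), p * q + p * r + q * r, - (p + q + r), 1:]"
    for p q r :: complex by (simp add: algebra_simps)
  have "y * (omega * y) * (omega\<^sup>2 * y) = y ^ 3"
    "y * (omega * y) + y * (omega\<^sup>2 * y) + omega * y * (omega\<^sup>2 * y) = 0"
    "y + omega * y + omega\<^sup>2 * y = 0" for y
    using omega_sum omega_cube by algebra+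
  then show ?thesis unfolding prod3 by (simp only: of_real_power minus_zero)
qed

lemma sum_zeros_diagonal_mop:
  fixes f :: "complex \<Rightarrow> complex"
  shows "(\<Sum>z\<in>#proots (diagonal_mop n). f z) = of_nat (2 * n mod 3) * f 0 +
    (\<Sum>s\<in>#cubed_zeros n. f (of_real (root 3 s)) + f (omega * of_real (root 3 s)) + f (omega\<^sup>2 * of_real (root 3 s)))"
proof -
  have "(\<Sum>z\<in>#proots (monom 1 r * (\<Prod>s\<in>#S. [:- complex_of_real s, 0, 0, 1:])). f z) = of_nat r * f 0 +
    (\<Sum>s\<in>#S. f (of_real (root 3 s)) + f (omega * of_real (root 3 s)) + f (omega\<^sup>2 * of_real (root 3 s)))" for r S
  proof (induction S)
    case empty
    have "(\<Sum>z\<in>#repeat_mset r {#0#}. f z) = of_nat r * f 0"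
      by (induction r) (simp_all add: algebra_simps)
    then show ?case
      using proots_linear_factor[of "0 :: complex"] by (simp add: monom_altdef proots_power)
  next
    case (add s S)
    let ?P = "\<Prod>s\<in>#S. [:- complex_of_real s, 0, 0, 1:]"
    have nz: "monom 1 r * ?P \<noteq> 0" by (auto simp: prod_mset_zero_iff)
    have "[:- complex_of_real s, 0, 0, 1:] = [:- complex_of_real (root 3 s ^ 3), 0, 0, 1:]"
      by (simp add: odd_real_root_pow)
    then have "monom 1 r * (\<Prod>s\<in>#add_mset s S. [:- complex_of_real s, 0, 0, 1:]) =
        [:- of_real (root 3 s), 1:] * [:- (omega * of_real (root 3 s)), 1:] * [:- (omega\<^sup>2 * of_real (root 3 s)), 1:]
          * (monom 1 r * ?P)"
      unfolding poly_cube_factor by (simp only: image_mset_add_mset prod_mset.add_mset mult_ac)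
    moreover have "proots \<dots> = {#of_real (root 3 s), omega * of_real (root 3 s), omega\<^sup>2 * of_real (root 3 s)#} + proots (monom 1 r * ?P)"
      using nz by (subst proots_mult) (simp_all add: proots_mult del: mult_pCons_left mult_pCons_right)
    ultimately show ?case using add by (simp add: add_ac)
  qed
  then show ?thesis using diagonal_mop_cubed_zeros[of n] by simp
qed

text \<open>Countable additivity of the set function inside \<open>measure_of\<close> comes from
  recognising it as the law of a uniformly random entry of a list of the zeros. A list keeps
  multiplicities, and \<open>n > 0\<close> makes the index set nonempty.\<close>

lemma zero_measure_eq_distr:
  assumes n: "n > 0" and xs: "mset xs = proots (diagonal_mop n)" and len: "length xs = 2 * n"
  shows "zero_measure n = distr (measure_pmf (pmf_of_set {..<2 * n})) borel
    (\<lambda>i. xs ! i / of_real (root 3 (real n)))"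
proof -
  define g where "g = (\<lambda>z. z / complex_of_real (root 3 (real n)))"
  define M where "M = distr (measure_pmf (pmf_of_set {..<2 * n})) borel (\<lambda>i. g (xs ! i))"
  have ne: "{..<2 * n} \<noteq> {}" using n by (simp add: lessThan_empty_iff)
  have eq: "emeasure M A = ennreal (1 / (2 * real n)) *
      (\<Sum>z\<in>#proots (diagonal_mop n). emeasure (return borel (g z)) A)" if A: "A \<in> sets borel" for A
  proof -
    have "emeasure M A = (\<integral>\<^sup>+ z. indicator A z \<partial>M)" using A by (simp add: M_def)
    also have "\<dots> = (\<integral>\<^sup>+ i. indicator A (g (xs ! i)) \<partial>measure_pmf (pmf_of_set {..<2 * n}))"
      unfolding M_def by (rule nn_integral_distr) (use A in simp_all)
    also have "\<dots> = (\<Sum>i<2 * n. indicator A (g (xs ! i))) / of_nat (2 * n)"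
      using ne by (subst nn_integral_pmf_of_set) simp_all
    also have "(\<Sum>i<2 * n. indicator A (g (xs ! i)) :: ennreal) = (\<Sum>z\<leftarrow>xs. indicator A (g z))"
      by (simp add: sum_list_sum_nth len lessThan_atLeast0)
    also have "\<dots> = (\<Sum>z\<in>#proots (diagonal_mop n). indicator A (g z))"
      unfolding xs[symmetric] mset_map[symmetric] by (simp only: sum_mset_sum_list)
    also have "\<dots> / of_nat (2 * n) = ennreal (1 / (2 * real n)) * \<dots>"
    proof -
      have "inverse (of_nat (2 * n) :: ennreal) = ennreal (1 / (2 * real n))"
        using n by (simp add: ennreal_of_nat_eq_real_of_nat inverse_ennreal inverse_eq_divide)
      then show ?thesis by (simp add: divide_ennreal_def mult.commute)
    qed
    finally show ?thesis using A by simp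
  qed
  have "zero_measure n = measure_of UNIV (sets borel) (emeasure M)"
    unfolding zero_measure_def
    by (rule measure_of_eq) (simp_all add: eq g_def sets.sigma_sets_eq[of borel, simplified])
  also have "\<dots> = M"
    using measure_of_of_measure[of M] by (simp add: M_def)
  finally show ?thesis by (simp add: M_def g_def)
qed

lemma integral_zero_measure:
  fixes f :: "complex \<Rightarrow> complex"
  assumes n: "n > 0" and f: "f \<in> borel_measurable borel" and deg: "degree (diagonal_mop n) = 2 * n"
  shows "integral\<^sup>L (zero_measure n) f =
    (\<Sum>z\<in>#proots (diagonal_mop n). f (z / of_real (root 3 (real n)))) / (2 * of_nat n)"
proof -
  obtain xs where xs: "mset xs = proots (diagonal_mop n)" using ex_mset by blast
  have len: "length xs = 2 * n"
    using arg_cong[OF xs, of size] by (simp add: size_proots_complex deg)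
  define h where "h = (\<lambda>z. f (z / of_real (root 3 (real n))))"
  have "integral\<^sup>L (zero_measure n) f = (LINT i|measure_pmf (pmf_of_set {..<2 * n}). h (xs ! i))"
    unfolding zero_measure_eq_distr[OF n xs len] h_def by (rule integral_distr) (use f in auto)
  also have "\<dots> = (\<Sum>i<2 * n. pmf (pmf_of_set {..<2 * n}) i *\<^sub>R h (xs ! i))"
    using n by (intro integral_measure_pmf) (auto simp: set_pmf_of_set lessThan_empty_iff)
  also have "\<dots> = (\<Sum>i<2 * n. h (xs ! i)) / (2 * of_nat n)"
    unfolding sum_divide_distrib
  proof (intro sum.cong refl)
    fix i assume "i \<in> {..<2 * n}"
    then have "pmf (pmf_of_set {..<2 * n}) i = 1 / (2 * real n)"
      using n by (auto simp: pmf_of_set lessThan_empty_iff)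
    then show "pmf (pmf_of_set {..<2 * n}) i *\<^sub>R h (xs ! i) = h (xs ! i) / (2 * of_nat n)"
      by (simp add: scaleR_conv_of_real)
  qed
  also have "(\<Sum>i<2 * n. h (xs ! i)) = (\<Sum>z\<leftarrow>xs. h z)"
    by (simp add: sum_list_sum_nth len lessThan_atLeast0)
  also have "\<dots> = (\<Sum>z\<in>#proots (diagonal_mop n). h z)"
    unfolding xs[symmetric] mset_map[symmetric] by (simp only: sum_mset_sum_list)
  finally show ?thesis by (simp add: h_def)
qed

section \<open>The limit measure and the conclusion\<close>

lemma borel_measurable_v_fun [measurable]: "v_fun \<in> borel_measurable borel"
  by (intro borel_measurable_continuous_onI continuous_intros)

text \<open>The measure is the law of \<open>omega ^ k * x\<close> with independent \<open>x\<close>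
  and \<open>k\<close>: \<open>k\<close> is uniform on three values and \<open>x\<close> has density
  \<open>3 * v_fun\<close>. The factor 3 normalises because \<open>v_fun\<close> has integral 1/3,
  one third of the mass for each ray.\<close>

lemma ex_limit_measure: "\<exists>M. is_limit_measure M"
proof -
  define d where "d = (\<lambda>x. 3 * (indicator {0..v_end} x * v_fun x))"
  have d_nonneg: "d x \<ge> 0" for x by (auto simp: d_def indicator_def v_fun_nonneg)
  have d_meas [measurable]: "d \<in> borel_measurable borel" unfolding d_def by measurable
  define N where "N = density lborel (\<lambda>x. ennreal (d x))"
  have "(v_fun has_integral 1 / 3) {0..v_end}" using v_fun_moment_has_integral[of 0] by simp
  then have "((\<lambda>x. 3 * v_fun x) has_integral 3 * (1 / 3)) {0..v_end}" by (rule has_integral_mult_right)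
  then have "((\<lambda>x. if x \<in> {0..v_end} then 3 * v_fun x else 0) has_integral 1) UNIV"
    by (subst has_integral_restrict_UNIV) simp
  also have "(\<lambda>x. if x \<in> {0..v_end} then 3 * v_fun x else 0) = d" by (auto simp: d_def)
  finally have "integral\<^sup>N lborel d = 1"
    using d_nonneg by (subst nn_integral_has_integral_lborel) auto
  then have "emeasure N (space N) = 1" by (simp add: N_def emeasure_density)
  then interpret N: prob_space N by (rule prob_spaceI)
  define K where "K = measure_pmf (pmf_of_set {..<3::nat})"
  interpret K: prob_space K unfolding K_def by (rule prob_space_measure_pmf)
  interpret NK: pair_prob_space N K ..
  define g where "g = (\<lambda>p. omega ^ snd p * complex_of_real (fst p))"
  have setsN [measurable_cong]: "sets N = sets borel" by (simp add: N_def)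
  have g [measurable]: "g \<in> borel_measurable (N \<Otimes>\<^sub>M K)"
  proof -
    have "(\<lambda>k. omega ^ k) \<in> borel_measurable K" by (simp add: K_def)
    then show ?thesis unfolding g_def by measurable
  qed
  define M where "M = distr (N \<Otimes>\<^sub>M K) borel g"
  have "is_limit_measure M"
    unfolding is_limit_measure_def v_end_def[symmetric]
  proof (intro conjI allI impI)
    show "prob_space M" unfolding M_def by (rule NK.prob_space_distr) simp
    show "sets M = sets borel" by (simp add: M_def)
    fix f :: "complex \<Rightarrow> complex" assume f [measurable]: "f \<in> borel_measurable borel" and B: "bounded (range f)"
    obtain C where C: "\<And>z. cmod (f z) \<le> C" using B by (auto simp: bounded_iff)
    have inner: "(LINT k|K. f (g (x, k))) =
        (f (of_real x) + f (omega * of_real x) + f (omega ^ 2 * of_real x)) / 3" for x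
    proof -
      have "(LINT k|K. f (g (x, k))) = (\<Sum>k<3. pmf (pmf_of_set {..<3}) k *\<^sub>R f (g (x, k)))"
        unfolding K_def by (rule integral_measure_pmf) (auto simp: set_pmf_of_set lessThan_empty_iff)
      also have "\<dots> = (f (of_real x) + f (omega * of_real x) + f (omega ^ 2 * of_real x)) / 3"
        by (simp add: pmf_of_set lessThan_empty_iff g_def eval_nat_numeral scaleR_conv_of_real field_simps)
      finally show ?thesis .
    qed
    have "integral\<^sup>L M f = (LINT p|(N \<Otimes>\<^sub>M K). f (g p))"
      unfolding M_def by (rule integral_distr) simp_all
    also have "\<dots> = (LINT x|N. LINT k|K. f (g (x, k)))"
      by (rule NK.integral_fst'[symmetric], rule NK.integrable_const_bound[of _ C]) (use C in simp_all)
    also have "\<dots> = (LINT x|lborel. d x *\<^sub>R ((f (of_real x) + f (omega * of_real x) + f (omega ^ 2 * of_real x)) / 3))"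
      unfolding inner N_def by (rule integral_density) (simp_all add: d_nonneg)
    also have "\<dots> = (LBINT x:{0..v_end}. of_real (v_fun x) *
        (f (of_real x) + f (omega * of_real x) + f (omega ^ 2 * of_real x)))"
      unfolding set_lebesgue_integral_def
      by (rule Bochner_Integration.integral_cong) (simp_all add: d_def scaleR_conv_of_real mult_ac)
    finally show "integral\<^sup>L M f = (LBINT x:{0..v_end}. of_real (v_fun x) *
        (f (of_real x) + f (omega * of_real x) + f (omega ^ 2 * of_real x)))" .
  qed
  then show ?thesis ..
qed

text \<open>Indicators of Borel sets are admissible test functions, so the prescribed integrals
  determine the measure of every Borel set.\<close>

lemma limit_measure_unique:
  assumes "is_limit_measure M" "is_limit_measure N"
  shows "M = N"
proof (rule measure_eqI)
  interpret M: prob_space M using assms(1) by (simp add: is_limit_measure_def)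
  interpret N: prob_space N using assms(2) by (simp add: is_limit_measure_def)
  have sets: "sets M = sets borel" "sets N = sets borel" using assms by (auto simp: is_limit_measure_def)
  then show "sets M = sets N" by simp
  fix A assume "A \<in> sets M"
  then have A: "A \<in> sets borel" "A \<in> sets M" "A \<in> sets N" using sets by auto
  define f where "f = (\<lambda>z. complex_of_real (indicator A z))"
  have "f \<in> borel_measurable borel" "bounded (range f)"
    using A by (auto simp: f_def bounded_iff indicator_def intro!: exI[of _ 1])
  then have "integral\<^sup>L M f = integral\<^sup>L N f"
    using assms unfolding is_limit_measure_def by simp
  then have "measure M A = measure N A"
    using A sets.sets_into_space[of A M] sets.sets_into_space[of A N] unfolding f_def by (simp add: Int_absorb2)
  then show "emeasure M A = emeasure N A"
    by (simp add: M.emeasure_eq_measure N.emeasure_eq_measure)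
qed

lemma degree_diagonal_mop: "degree (diagonal_mop n) = 2 * n"
  by (rule diagonal_mop_eq[of n])

text \<open>The test function is symmetrised over the three cube roots: \<open>F (s / n)\<close>
  collects the values of \<open>f\<close> at the scaled zeros belonging to \<open>s\<close>, and
  \<open>F (x ^ 3)\<close> is the bracket in the limit integral. The real cube root is continuous on
  the whole line, so \<open>F\<close> is again bounded and continuous.\<close>

lemma zero_measure_converges_weakly:
  assumes "is_limit_measure M"
  shows "converges_weakly zero_measure M"
  unfolding converges_weakly_def
proof (intro allI impI)
  fix f :: "complex \<Rightarrow> complex" assume f: "continuous_on UNIV f" and B: "bounded (range f)"
  have meas: "f \<in> borel_measurable borel" using f by (rule borel_measurable_continuous_onI)
  define F where "F = (\<lambda>y. f (of_real (root 3 y)) + f (omega * of_real (root 3 y)) + f (omega\<^sup>2 * of_real (root 3 y)))"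
  have F_cont: "continuous_on UNIV F"
    unfolding F_def by (intro continuous_intros continuous_on_compose2[OF f]) auto
  obtain C where C: "\<And>z. cmod (f z) \<le> C" using B by (auto simp: bounded_iff)
  then have C0: "C \<ge> 0" using norm_ge_zero order_trans by blast
  have "cmod (F y) \<le> C + C + C" for y
    unfolding F_def by (intro norm_triangle_mono C)
  then have "bounded (range F)" by (auto simp: bounded_iff)
  from cubed_zeros_tendsto[OF F_cont this]
  have "(\<lambda>n. (\<Sum>s\<in>#cubed_zeros n. F (s / real n)) / (2 * of_nat n)) \<longlonglongrightarrow>
      (LBINT x:{0..v_end}. of_real (v_fun x) * F (x ^ 3))" .
  also have "(LBINT x:{0..v_end}. of_real (v_fun x) * F (x ^ 3)) = integral\<^sup>L M f"
  proof -
    have "(LBINT x:{0..v_end}. of_real (v_fun x) * F (x ^ 3)) = (LBINT x:{0..v_end}. of_real (v_fun x) *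
        (f (of_real x) + f (omega * of_real x) + f (omega ^ 2 * of_real x)))"
      by (rule set_lebesgue_integral_cong) (auto simp: F_def real_root_power_cancel)
    then show ?thesis
      using assms meas B unfolding is_limit_measure_def v_end_def[symmetric] by simp
  qed
  finally have main: "(\<lambda>n. (\<Sum>s\<in>#cubed_zeros n. F (s / real n)) / (2 * of_nat n)) \<longlonglongrightarrow> integral\<^sup>L M f" .
  \<comment> \<open>The zero at the origin has multiplicity at most 2, so its share of the
    normalised count vanishes in the limit.\<close>
  have "(\<lambda>n. of_nat (2 * n mod 3) * f 0 / (2 * of_nat n)) \<longlonglongrightarrow> 0"
  proof (rule Lim_null_comparison)
    show "(\<lambda>n. 2 * C / real n) \<longlonglongrightarrow> 0" by (rule lim_const_over_n)
    show "\<forall>\<^sub>F n in sequentially. norm (of_nat (2 * n mod 3) * f 0 / (2 * of_nat n)) \<le> 2 * C / real n"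
    proof (intro always_eventually allI)
      fix n
      have "real (2 * n mod 3) \<le> 2" by linarith
      then have "real (2 * n mod 3) * cmod (f 0) \<le> 2 * C"
        using C[of 0] by (intro mult_mono) auto
      moreover have "0 \<le> real (2 * n mod 3) * cmod (f 0)" by simp
      ultimately have "real (2 * n mod 3) * cmod (f 0) / (2 * real n) \<le> 2 * C / real n"
        using C0 by (cases "n = 0") (auto intro!: frac_le)
      then show "norm (of_nat (2 * n mod 3) * f 0 / (2 * of_nat n)) \<le> 2 * C / real n"
        by (simp add: norm_divide norm_mult)
    qed
  qed
  from tendsto_add[OF this main]
  have "(\<lambda>n. of_nat (2 * n mod 3) * f 0 / (2 * of_nat n) +
      (\<Sum>s\<in>#cubed_zeros n. F (s / real n)) / (2 * of_nat n)) \<longlonglongrightarrow> integral\<^sup>L M f" by simp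
  moreover have "\<forall>\<^sub>F n in sequentially. of_nat (2 * n mod 3) * f 0 / (2 * of_nat n) +
      (\<Sum>s\<in>#cubed_zeros n. F (s / real n)) / (2 * of_nat n) = integral\<^sup>L (zero_measure n) f"
    using eventually_gt_at_top[of 0]
  proof eventually_elim
    case (elim n)
    have "integral\<^sup>L (zero_measure n) f =
        (\<Sum>z\<in>#proots (diagonal_mop n). f (z / of_real (root 3 (real n)))) / (2 * of_nat n)"
      using elim meas degree_diagonal_mop by (rule integral_zero_measure)
    also have "\<dots> = of_nat (2 * n mod 3) * f 0 / (2 * of_nat n) +
      (\<Sum>s\<in>#cubed_zeros n. F (s / real n)) / (2 * of_nat n)"
      unfolding sum_zeros_diagonal_mop by (simp add: F_def real_root_divide add_divide_distrib)
    finally show ?case ..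
  qed
  ultimately show "(\<lambda>n. integral\<^sup>L (zero_measure n) f) \<longlonglongrightarrow> integral\<^sup>L M f"
    by (rule Lim_transform_eventually)
qed

theorem corollary4p3:
  shows "(\<exists>!M. is_limit_measure M) \<and>
         (\<forall>M. is_limit_measure M \<longrightarrow> converges_weakly zero_measure M)"
  using ex_limit_measure limit_measure_unique zero_measure_converges_weakly by blast

end
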